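(* Let $X$ be a second countable compact Hausdorff space, $\mathcal{A}$ a separable unital C*-algebra, $H$ a Hilbert space, $\mu$ a non-atomic Borel probability measure on $X$, and, for each $x\in X$, let $\phi_x:\mathcal{A}\to\mathcal{B}(H)$ be a unital completely positive map, such that the family $(\phi_x)_{x\in X}$ is $\mu$-measurable. Then there exist a Hilbert space $K$, an isometry $V:H\to K$ and a $\mu$-measurable family $(\pi_x)_{x\in X}$ of unital $*$-representations of $\mathcal{A}$ on $K$ such that $$\phi_x(u)=V^*\pi_x(u)V,\qquad u\in\mathcal{A},\ x\in X.$$
   Context: For a Borel measure $\mu$ on $X$, a scalar function on $X$ is $\mu$-measurable if it is measurable with respect to the $\mu$-completion $\mathfrak{A}_\mu$ of the Borel $\sigma$-algebra of $X$. A family $(\phi_x)_{x\in X}$ of maps $\mathcal{A}\to\mathcal{B}(H)$ is $\mu$-measurable if for all $u\in\mathcal{A}$ and $\xi,\eta\in H$ the function $x\mapsto\langle\phi_x(u)\xi,\eta\rangle$ is $\mu$-measurable. The Hilbert spaces $H$ and $K$ are not assumed separable. *)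

theory Defs
  imports "HOL-Probability.Probability"
begin

section \<open>Unital C*-algebras\<close>

text \<open>
  The axiom \<open>0 \<noteq> 1\<close> is not imposed, so the zero algebra is an instance.  The axiom
  \<open>scaleR_scaleC\<close> says that the real scalar multiplication inherited from
  \<open>real_normed_algebra\<close> is the restriction of the complex one; it also yields
  \<open>scaleC 1 x = x\<close>.
\<close>

class unital_cstar_algebra = real_normed_algebra + banach + monoid_mult +
  fixes scaleC :: "complex \<Rightarrow> 'a \<Rightarrow> 'a"  (infixr \<open>*\<^sub>C\<close> 75)
    and star :: "'a \<Rightarrow> 'a"
  assumes scaleC_add_right: "c *\<^sub>C (x + y) = c *\<^sub>C x + c *\<^sub>C y"
    and scaleC_add_left: "(c + d) *\<^sub>C x = c *\<^sub>C x + d *\<^sub>C x"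
    and scaleC_scaleC: "c *\<^sub>C d *\<^sub>C x = (c * d) *\<^sub>C x"
    and scaleR_scaleC: "r *\<^sub>R x = complex_of_real r *\<^sub>C x"
    and mult_scaleC_left: "(c *\<^sub>C x) * y = c *\<^sub>C (x * y)"
    and mult_scaleC_right: "x * (c *\<^sub>C y) = c *\<^sub>C (x * y)"
    and norm_scaleC: "norm (c *\<^sub>C x) = cmod c * norm x"
    and star_star: "star (star x) = x"
    and star_add: "star (x + y) = star x + star y"
    and star_scaleC: "star (c *\<^sub>C x) = cnj c *\<^sub>C star x"
    and star_mult: "star (x * y) = star y * star x"
    and cstar_identity: "norm (star x * x) = (norm x)\<^sup>2"

section \<open>Hilbert spaces\<close>

text \<open>
  Hilbert spaces are structures with an explicit carrier rather than types, because they have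
  to be quantified existentially.  The inner product is linear in its first argument.
\<close>

record 'h hilbert =
  hcarrier :: "'h set"
  hadd :: "'h \<Rightarrow> 'h \<Rightarrow> 'h"
  hzero :: 'h
  hscale :: "complex \<Rightarrow> 'h \<Rightarrow> 'h"
  hinner :: "'h \<Rightarrow> 'h \<Rightarrow> complex"

definition hnorm :: "'h hilbert \<Rightarrow> 'h \<Rightarrow> real" where
  "hnorm H \<xi> = sqrt (Re (hinner H \<xi> \<xi>))"

text \<open>
  The value \<open>0\<close> off the carrier is there because the locale \<open>Metric_space\<close> demands symmetry
  and nonnegativity of the distance on the whole type.
\<close>

definition hdist :: "'h hilbert \<Rightarrow> 'h \<Rightarrow> 'h \<Rightarrow> real" where
  "hdist H \<xi> \<eta> =
     (if \<xi> \<in> hcarrier H \<and> \<eta> \<in> hcarrier H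
      then hnorm H (hadd H \<xi> (hscale H (- 1) \<eta>)) else 0)"

locale hilbert_space =
  fixes H :: "'h hilbert"
  assumes add_closed: "\<lbrakk>\<xi> \<in> hcarrier H; \<eta> \<in> hcarrier H\<rbrakk> \<Longrightarrow> hadd H \<xi> \<eta> \<in> hcarrier H"
    and zero_closed: "hzero H \<in> hcarrier H"
    and scale_closed: "\<xi> \<in> hcarrier H \<Longrightarrow> hscale H c \<xi> \<in> hcarrier H"
    and add_assoc: "\<lbrakk>\<xi> \<in> hcarrier H; \<eta> \<in> hcarrier H; \<zeta> \<in> hcarrier H\<rbrakk>
      \<Longrightarrow> hadd H (hadd H \<xi> \<eta>) \<zeta> = hadd H \<xi> (hadd H \<eta> \<zeta>)"
    and add_commute: "\<lbrakk>\<xi> \<in> hcarrier H; \<eta> \<in> hcarrier H\<rbrakk> \<Longrightarrow> hadd H \<xi> \<eta> = hadd H \<eta> \<xi>"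
    and add_zero: "\<xi> \<in> hcarrier H \<Longrightarrow> hadd H \<xi> (hzero H) = \<xi>"
    and add_inverse: "\<xi> \<in> hcarrier H \<Longrightarrow> \<exists>\<eta>\<in>hcarrier H. hadd H \<xi> \<eta> = hzero H"
    and scale_one: "\<xi> \<in> hcarrier H \<Longrightarrow> hscale H 1 \<xi> = \<xi>"
    and scale_scale: "\<xi> \<in> hcarrier H \<Longrightarrow> hscale H c (hscale H d \<xi>) = hscale H (c * d) \<xi>"
    and scale_add_right: "\<lbrakk>\<xi> \<in> hcarrier H; \<eta> \<in> hcarrier H\<rbrakk>
      \<Longrightarrow> hscale H c (hadd H \<xi> \<eta>) = hadd H (hscale H c \<xi>) (hscale H c \<eta>)"
    and scale_add_left: "\<xi> \<in> hcarrier H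
      \<Longrightarrow> hscale H (c + d) \<xi> = hadd H (hscale H c \<xi>) (hscale H d \<xi>)"
    and inner_add_left: "\<lbrakk>\<xi> \<in> hcarrier H; \<eta> \<in> hcarrier H; \<zeta> \<in> hcarrier H\<rbrakk>
      \<Longrightarrow> hinner H (hadd H \<xi> \<eta>) \<zeta> = hinner H \<xi> \<zeta> + hinner H \<eta> \<zeta>"
    and inner_scale_left: "\<lbrakk>\<xi> \<in> hcarrier H; \<eta> \<in> hcarrier H\<rbrakk>
      \<Longrightarrow> hinner H (hscale H c \<xi>) \<eta> = c * hinner H \<xi> \<eta>"
    and inner_commute: "\<lbrakk>\<xi> \<in> hcarrier H; \<eta> \<in> hcarrier H\<rbrakk>
      \<Longrightarrow> hinner H \<xi> \<eta> = cnj (hinner H \<eta> \<xi>)"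
    and inner_nonneg: "\<xi> \<in> hcarrier H \<Longrightarrow> hinner H \<xi> \<xi> \<in> \<real>\<^sub>\<ge>\<^sub>0"
    and inner_definite: "\<lbrakk>\<xi> \<in> hcarrier H; hinner H \<xi> \<xi> = 0\<rbrakk> \<Longrightarrow> \<xi> = hzero H"
    and complete: "Metric_space.mcomplete (hcarrier H) (hdist H)"

section \<open>Operators\<close>

text \<open>Operators are functions on the ambient type; only their values on the carrier matter.\<close>

definition linear_op :: "'h hilbert \<Rightarrow> 'k hilbert \<Rightarrow> ('h \<Rightarrow> 'k) \<Rightarrow> bool" where
  "linear_op H K T \<longleftrightarrow>
     (\<forall>\<xi>\<in>hcarrier H. T \<xi> \<in> hcarrier K) \<and>
     (\<forall>\<xi>\<in>hcarrier H. \<forall>\<eta>\<in>hcarrier H. T (hadd H \<xi> \<eta>) = hadd K (T \<xi>) (T \<eta>)) \<and>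
     (\<forall>c. \<forall>\<xi>\<in>hcarrier H. T (hscale H c \<xi>) = hscale K c (T \<xi>))"

definition bounded_op :: "'h hilbert \<Rightarrow> 'k hilbert \<Rightarrow> ('h \<Rightarrow> 'k) \<Rightarrow> bool" where
  "bounded_op H K T \<longleftrightarrow>
     linear_op H K T \<and> (\<exists>M. \<forall>\<xi>\<in>hcarrier H. hnorm K (T \<xi>) \<le> M * hnorm H \<xi>)"

definition isometry_op :: "'h hilbert \<Rightarrow> 'k hilbert \<Rightarrow> ('h \<Rightarrow> 'k) \<Rightarrow> bool" where
  "isometry_op H K V \<longleftrightarrow>
     linear_op H K V \<and> (\<forall>\<xi>\<in>hcarrier H. hnorm K (V \<xi>) = hnorm H \<xi>)"

text \<open>Unique existence of the described vector for bounded \<open>T\<close> is the Riesz theorem.\<close>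

definition adj_op :: "'h hilbert \<Rightarrow> 'k hilbert \<Rightarrow> ('h \<Rightarrow> 'k) \<Rightarrow> 'k \<Rightarrow> 'h" where
  "adj_op H K T \<eta> =
     (THE \<zeta>. \<zeta> \<in> hcarrier H \<and> (\<forall>\<xi>\<in>hcarrier H. hinner K (T \<xi>) \<eta> = hinner H \<xi> \<zeta>))"

section \<open>Completely positive maps and representations\<close>

definition linear_to_B ::
    "'h hilbert \<Rightarrow> ('a::unital_cstar_algebra \<Rightarrow> 'h \<Rightarrow> 'h) \<Rightarrow> bool" where
  "linear_to_B H \<phi> \<longleftrightarrow>
     (\<forall>u. bounded_op H H (\<phi> u)) \<and>
     (\<forall>u v. \<forall>\<xi>\<in>hcarrier H. \<phi> (u + v) \<xi> = hadd H (\<phi> u \<xi>) (\<phi> v \<xi>)) \<and>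
     (\<forall>c u. \<forall>\<xi>\<in>hcarrier H. \<phi> (c *\<^sub>C u) \<xi> = hscale H c (\<phi> u \<xi>))"

definition unital_to_B ::
    "'h hilbert \<Rightarrow> ('a::unital_cstar_algebra \<Rightarrow> 'h \<Rightarrow> 'h) \<Rightarrow> bool" where
  "unital_to_B H \<phi> \<longleftrightarrow> (\<forall>\<xi>\<in>hcarrier H. \<phi> 1 \<xi> = \<xi>)"

text \<open>
  An \<open>n \<times> n\<close> matrix over the algebra is a function of two indices, of which only the values at
  indices \<open>< n\<close> matter.  It is positive in the C*-algebra of \<open>n \<times> n\<close> matrices if it is of the
  form \<open>b\<^sup>* b\<close>.
\<close>

definition positive_matrix :: "nat \<Rightarrow> (nat \<Rightarrow> nat \<Rightarrow> 'a::unital_cstar_algebra) \<Rightarrow> bool" where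
  "positive_matrix n a \<longleftrightarrow>
     (\<exists>b. \<forall>i<n. \<forall>j<n. a i j = (\<Sum>k<n. star (b k i) * b k j))"

text \<open>Positivity of the operator on the \<open>n\<close>-fold direct sum of \<open>H\<close> with matrix \<open>T\<close>.\<close>

definition positive_op_matrix :: "'h hilbert \<Rightarrow> nat \<Rightarrow> (nat \<Rightarrow> nat \<Rightarrow> 'h \<Rightarrow> 'h) \<Rightarrow> bool" where
  "positive_op_matrix H n T \<longleftrightarrow>
     (\<forall>\<xi>. (\<forall>i<n. \<xi> i \<in> hcarrier H) \<longrightarrow>
        (\<Sum>i<n. \<Sum>j<n. hinner H (T i j (\<xi> j)) (\<xi> i)) \<in> \<real>\<^sub>\<ge>\<^sub>0)"

definition completely_positive ::
    "'h hilbert \<Rightarrow> ('a::unital_cstar_algebra \<Rightarrow> 'h \<Rightarrow> 'h) \<Rightarrow> bool" where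
  "completely_positive H \<phi> \<longleftrightarrow>
     linear_to_B H \<phi> \<and>
     (\<forall>n a. positive_matrix n a \<longrightarrow> positive_op_matrix H n (\<lambda>i j. \<phi> (a i j)))"

definition unital_star_rep ::
    "'h hilbert \<Rightarrow> ('a::unital_cstar_algebra \<Rightarrow> 'h \<Rightarrow> 'h) \<Rightarrow> bool" where
  "unital_star_rep K \<pi> \<longleftrightarrow>
     linear_to_B K \<pi> \<and> unital_to_B K \<pi> \<and>
     (\<forall>u v. \<forall>\<xi>\<in>hcarrier K. \<pi> (u * v) \<xi> = \<pi> u (\<pi> v \<xi>)) \<and>
     (\<forall>u. \<forall>\<xi>\<in>hcarrier K. \<pi> (star u) \<xi> = adj_op K K (\<pi> u) \<xi>)"

section \<open>Measure theory\<close>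

definition nonatomic :: "'x measure \<Rightarrow> bool" where
  "nonatomic M \<longleftrightarrow>
     (\<forall>A\<in>sets M. 0 < emeasure M A \<longrightarrow>
        (\<exists>B\<in>sets M. B \<subseteq> A \<and> 0 < emeasure M B \<and> emeasure M B < emeasure M A))"

definition measurable_family ::
    "'x measure \<Rightarrow> 'h hilbert \<Rightarrow> ('x \<Rightarrow> 'a \<Rightarrow> 'h \<Rightarrow> 'h) \<Rightarrow> bool" where
  "measurable_family M H \<phi> \<longleftrightarrow>
     (\<forall>u. \<forall>\<xi>\<in>hcarrier H. \<forall>\<eta>\<in>hcarrier H.
        (\<lambda>x. hinner H (\<phi> x u \<xi>) \<eta>) \<in> borel_measurable (completion M))"

text \<open>
  HOL cannot quantify existentially over types, so a statement that asserts the existence of a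
  Hilbert space has to name the type of its vectors.  The complex functions on
  \<open>'x \<times> 'a \<times> 'h \<times> nat\<close> leave enough room: they contain the square summable families indexed by
  a set that is infinite and at least as large as the space \<open>'x\<close>, the algebra \<open>'a\<close> and the
  type \<open>'h\<close> of the vectors of the given Hilbert space.  Neither the carrier nor the operations
  of the Hilbert space structure on this type are prescribed.
\<close>

type_synonym ('x, 'a, 'h) dilation_vec = "'x \<times> 'a \<times> 'h \<times> nat \<Rightarrow> complex"

end

theory Submission
  imports Defs
begin

text \<open>
  Let \<open>K\<^sub>x\<close> be the Stinespring space of \<open>\<phi>\<^sub>x\<close>, which contains \<open>H\<close>, and let \<open>K\<close> be the direct sum
  of \<open>H\<close> and of countably many copies of \<open>K\<^sub>x\<close> for every \<open>x\<close>.  Write \<open>M\<^sub>x\<close> for the complement of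
  \<open>H\<close> in \<open>K\<^sub>x\<close>.  The sum of \<open>H\<close> and of the copies \<open>H\<^sub>n \<oplus> M\<^sub>n\<close> \<open>(n \<ge> 1)\<close> of \<open>K\<^sub>x\<close> can be rearranged
  as a sum of copies \<open>H\<^sub>n\<^sub>-\<^sub>1 \<oplus> M\<^sub>n\<close> of \<open>K\<^sub>x\<close>, where \<open>H\<^sub>0 = H\<close>.  Let \<open>\<pi>\<^sub>x\<close> act by the Stinespring
  representation on each of these rearranged copies, and by that of \<open>\<phi>\<^sub>y\<close> on the original copies
  of \<open>K\<^sub>y\<close> for \<open>y \<noteq> x\<close>.  Its compression to \<open>H\<close> is \<open>\<phi>\<^sub>x\<close>.  Vectors of \<open>K\<close> have countably many nonzero
  components, hence a coefficient of \<open>\<pi>\<^sub>x(u)\<close> differs from a coefficient of \<open>\<phi>\<^sub>x(u)\<close> plus a constant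
  at countably many points \<open>x\<close> only, which makes it measurable.

  The space \<open>K\<close> is realised as the reproducing kernel Hilbert space of a kernel on a set of
  generators.  All operators are given on finite formal sums (lists) of generators, together with
  their formal adjoints, and extend to the completion by way of the latter.
\<close>

section \<open>Semi-inner products\<close>

text \<open>One instance consists of lists under concatenation, so no vector space laws are imposed
  on \<open>add\<close> and \<open>scale\<close>: the identities below are identities between values
  of \<open>B\<close>.\<close>

locale semi_inner =
  fixes S :: "'d set" and add :: "'d \<Rightarrow> 'd \<Rightarrow> 'd" and scale :: "complex \<Rightarrow> 'd \<Rightarrow> 'd"
    and B :: "'d \<Rightarrow> 'd \<Rightarrow> complex"
  assumes add_in [simp]: "\<lbrakk>d \<in> S; e \<in> S\<rbrakk> \<Longrightarrow> add d e \<in> S"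
    and scale_in [simp]: "d \<in> S \<Longrightarrow> scale c d \<in> S"
    and B_add_left [simp]: "\<lbrakk>d \<in> S; e \<in> S; f \<in> S\<rbrakk> \<Longrightarrow> B (add d e) f = B d f + B e f"
    and B_add_right [simp]: "\<lbrakk>d \<in> S; e \<in> S; f \<in> S\<rbrakk> \<Longrightarrow> B d (add e f) = B d e + B d f"
    and B_scale_left [simp]: "\<lbrakk>d \<in> S; e \<in> S\<rbrakk> \<Longrightarrow> B (scale c d) e = c * B d e"
    and B_scale_right [simp]: "\<lbrakk>d \<in> S; e \<in> S\<rbrakk> \<Longrightarrow> B d (scale c e) = cnj c * B d e"
    and B_nonneg: "d \<in> S \<Longrightarrow> B d d \<in> \<real>\<^sub>\<ge>\<^sub>0"
begin

lemma Re_B_self_nonneg: "d \<in> S \<Longrightarrow> 0 \<le> Re (B d d)"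
  using B_nonneg by (auto simp: complex_nonneg_Reals_iff)

lemma Im_B_self: "d \<in> S \<Longrightarrow> Im (B d d) = 0"
  using B_nonneg by (auto simp: complex_nonneg_Reals_iff)

text \<open>Polarization: \<open>B\<close> is real on the diagonal at d + e and at d + \<i> e, which
  compares the imaginary and the real parts of the two values.\<close>

lemma B_hermitian:
  assumes "d \<in> S" "e \<in> S"
  shows "B d e = cnj (B e d)"
proof -
  have *: "Im (B (add d (scale c e)) (add d (scale c e))) = 0" for c
    using assms by (intro Im_B_self) auto
  show ?thesis
    using *[of 1] *[of \<i>] assms
    by (simp add: Im_B_self complex_eq_iff algebra_simps)
qed

definition seminorm :: "'d \<Rightarrow> real" where "seminorm d = sqrt (Re (B d d))"

lemma seminorm_nonneg [simp]: "d \<in> S \<Longrightarrow> 0 \<le> seminorm d"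
  by (simp add: seminorm_def Re_B_self_nonneg)

lemma seminorm_sq: "d \<in> S \<Longrightarrow> (seminorm d)\<^sup>2 = Re (B d d)"
  by (simp add: seminorm_def Re_B_self_nonneg)

lemma Cauchy_Schwarz:
  assumes "d \<in> S" "e \<in> S"
  shows "cmod (B d e) \<le> seminorm d * seminorm e"
proof -
  define a b c where "a = Re (B d d)" and "b = cmod (B d e)" and "c = Re (B e e)"
  have ge: "0 \<le> a - 2 * s * b\<^sup>2 + s\<^sup>2 * b\<^sup>2 * c" for s :: real
  proof -
    \<comment> \<open>The factor \<open>B d e\<close> makes the cross terms real, so that a real
      quadratic in s results.\<close>
    let ?t = "- of_real s * B d e"
    have "Re (B (add d (scale ?t e)) (add d (scale ?t e))) = a - 2 * s * b\<^sup>2 + s\<^sup>2 * b\<^sup>2 * c"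
      using assms B_hermitian[of e d]
      by (simp add: a_def b_def c_def cmod_power2 Im_B_self) (simp add: power2_eq_square algebra_simps)
    moreover have "0 \<le> Re (B (add d (scale ?t e)) (add d (scale ?t e)))"
      using assms by (intro Re_B_self_nonneg) auto
    ultimately show ?thesis by simp
  qed
  have ac: "0 \<le> a" "0 \<le> c"
    using assms by (auto simp: a_def c_def Re_B_self_nonneg)
  have "b\<^sup>2 \<le> a * c"
  proof (cases "c = 0")
    case True
    have "b = 0"
    proof (rule ccontr)
      assume "b \<noteq> 0"
      \<comment> \<open>For degenerate \<open>B\<close> the quadratic is affine in s; at this s it
        equals -1.\<close>
      then show False using ge[of "(a + 1) / (2 * b\<^sup>2)"] True ac by (simp add: field_simps)
    qed
    then show ?thesis using True by simp
  next
    case False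
    \<comment> \<open>At s = 1 / c the quadratic has its minimum a - b^2 / c.\<close>
    then show ?thesis using ge[of "1 / c"] ac by (simp add: field_simps power2_eq_square)
  qed
  also have "\<dots> = (seminorm d * seminorm e)\<^sup>2"
    using assms by (simp add: power_mult_distrib seminorm_sq a_def c_def)
  finally show ?thesis
    unfolding b_def using assms by (auto intro: power2_le_imp_le)
qed

lemma seminorm_triangle:
  assumes "d \<in> S" "e \<in> S"
  shows "seminorm (add d e) \<le> seminorm d + seminorm e"
proof -
  have "Re (B d e) \<le> seminorm d * seminorm e"
    using Cauchy_Schwarz[OF assms] complex_Re_le_cmod order_trans by blast
  moreover have "Re (B e d) = Re (B d e)"
    using B_hermitian[OF assms] by simp
  ultimately have "(seminorm (add d e))\<^sup>2 \<le> (seminorm d + seminorm e)\<^sup>2"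
    using assms by (simp add: seminorm_sq power2_sum)
  then show ?thesis
    using assms by (auto intro: power2_le_imp_le)
qed

lemma seminorm_scale:
  assumes "d \<in> S"
  shows "seminorm (scale c d) = cmod c * seminorm d"
proof -
  have "B (scale c d) (scale c d) = of_real ((cmod c)\<^sup>2) * B d d"
    using assms complex_norm_square[of c] by (simp add: mult.assoc)
  then show ?thesis by (simp add: seminorm_def real_sqrt_mult)
qed

section \<open>The induced pseudometric\<close>

definition sdist :: "'d \<Rightarrow> 'd \<Rightarrow> real" where "sdist d e = seminorm (add d (scale (- 1) e))"

lemma sdist_nonneg [simp]: "\<lbrakk>d \<in> S; e \<in> S\<rbrakk> \<Longrightarrow> 0 \<le> sdist d e"
  by (simp add: sdist_def)

lemma sdist_commute: "\<lbrakk>d \<in> S; e \<in> S\<rbrakk> \<Longrightarrow> sdist d e = sdist e d"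
  by (simp add: sdist_def seminorm_def algebra_simps)

lemma sdist_triangle:
  assumes "d \<in> S" "e \<in> S" "f \<in> S"
  shows "sdist d f \<le> sdist d e + sdist e f"
proof -
  let ?m = "\<lambda>d e. add d (scale (- 1) e)"
  \<comment> \<open>The two sides may be seminorms of distinct elements; the contributions of
    \<open>e\<close> cancel inside \<open>B\<close>.\<close>
  have "sdist d f = seminorm (add (?m d e) (?m e f))"
    using assms by (simp add: sdist_def seminorm_def)
  also have "\<dots> \<le> sdist d e + sdist e f"
    unfolding sdist_def using assms by (intro seminorm_triangle) auto
  finally show ?thesis .
qed

lemma seminorm_le_sdist:
  assumes "d \<in> S" "e \<in> S"
  shows "seminorm d \<le> sdist d e + seminorm e"
proof -
  have "seminorm d = seminorm (add (add d (scale (- 1) e)) e)"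
    using assms by (simp add: seminorm_def)
  also have "\<dots> \<le> sdist d e + seminorm e"
    unfolding sdist_def using assms by (intro seminorm_triangle) auto
  finally show ?thesis .
qed

lemma sdist_add_add:
  assumes "d \<in> S" "e \<in> S" "d' \<in> S" "e' \<in> S"
  shows "sdist (add d e) (add d' e') \<le> sdist d d' + sdist e e'"
proof -
  let ?m = "\<lambda>d e. add d (scale (- 1) e)"
  have "sdist (add d e) (add d' e') = seminorm (add (?m d d') (?m e e'))"
    using assms by (simp add: sdist_def seminorm_def)
  also have "\<dots> \<le> sdist d d' + sdist e e'"
    unfolding sdist_def using assms by (intro seminorm_triangle) auto
  finally show ?thesis .
qed

lemma sdist_scale_scale:
  assumes "d \<in> S" "e \<in> S"
  shows "sdist (scale c d) (scale c e) = cmod c * sdist d e"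
proof -
  have "sdist (scale c d) (scale c e) = seminorm (scale c (add d (scale (- 1) e)))"
    using assms by (simp add: sdist_def seminorm_def algebra_simps)
  then show ?thesis
    using assms by (simp add: seminorm_scale sdist_def)
qed

lemma B_diff_le:
  assumes "d \<in> S" "e \<in> S" "d' \<in> S" "e' \<in> S"
  shows "cmod (B d e - B d' e') \<le> sdist d d' * seminorm e + seminorm d' * sdist e e'"
proof -
  have "B d e - B d' e' = B (add d (scale (- 1) d')) e + B d' (add e (scale (- 1) e'))"
    using assms by simp
  also have "cmod \<dots> \<le> sdist d d' * seminorm e + seminorm d' * sdist e e'"
    unfolding sdist_def using assms
    by (intro order_trans[OF norm_triangle_ineq] add_mono Cauchy_Schwarz) auto
  finally show ?thesis .
qed

section \<open>Cauchy sequences\<close>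

definition cauchy_seq :: "(nat \<Rightarrow> 'd) \<Rightarrow> bool" where
  "cauchy_seq d \<longleftrightarrow> range d \<subseteq> S \<and> (\<forall>\<epsilon>>0. \<exists>M. \<forall>m\<ge>M. \<forall>n\<ge>M. sdist (d m) (d n) < \<epsilon>)"

lemma cauchy_seq_in: "cauchy_seq d \<Longrightarrow> d n \<in> S"
  by (auto simp: cauchy_seq_def)

lemma cauchy_seqD:
  assumes "cauchy_seq d" "0 < \<epsilon>"
  shows "\<exists>M. \<forall>m\<ge>M. \<forall>n\<ge>M. sdist (d m) (d n) < \<epsilon>"
  using assms by (auto simp: cauchy_seq_def)

lemma cauchy_seq_bounded:
  assumes "cauchy_seq d"
  obtains C where "0 < C" "\<And>n. seminorm (d n) \<le> C"
proof -
  note [simp] = cauchy_seq_in[OF assms]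
  obtain M where M: "\<And>m n. m \<ge> M \<Longrightarrow> n \<ge> M \<Longrightarrow> sdist (d m) (d n) < 1"
    using cauchy_seqD[OF assms, of 1] by auto
  define C where "C = (\<Sum>n\<le>M. seminorm (d n)) + 1"
  have le: "seminorm (d n) \<le> (\<Sum>n\<le>M. seminorm (d n))" if "n \<le> M" for n
    using that by (intro member_le_sum) auto
  have "seminorm (d n) \<le> C" for n
  proof (cases "n \<le> M")
    case True
    then show ?thesis using le[of n] by (simp add: C_def)
  next
    case False
    have "seminorm (d n) \<le> sdist (d n) (d M) + seminorm (d M)"
      by (intro seminorm_le_sdist) auto
    then show ?thesis using M[of n M] False le[of M] by (simp add: C_def)
  qed
  moreover have "0 < C"
    unfolding C_def by (intro add_nonneg_pos sum_nonneg) auto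
  ultimately show ?thesis using that by blast
qed

lemma convergent_B:
  assumes "cauchy_seq d" "cauchy_seq e"
  shows "convergent (\<lambda>n. B (d n) (e n))"
proof -
  note [simp] = cauchy_seq_in[OF assms(1)] cauchy_seq_in[OF assms(2)]
  obtain C where C: "0 < C" "\<And>n. seminorm (d n) \<le> C" using cauchy_seq_bounded[OF assms(1)] by blast
  obtain C' where C': "0 < C'" "\<And>n. seminorm (e n) \<le> C'" using cauchy_seq_bounded[OF assms(2)] by blast
  have "Cauchy (\<lambda>n. B (d n) (e n))"
  proof (rule CauchyI)
    fix \<epsilon> :: real assume "0 < \<epsilon>"
    then have "0 < \<epsilon> / (2 * C')" "0 < \<epsilon> / (2 * C)" using C C' by auto
    then obtain M M' where
      M: "\<And>m n. m \<ge> M \<Longrightarrow> n \<ge> M \<Longrightarrow> sdist (d m) (d n) < \<epsilon> / (2 * C')" and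
      M': "\<And>m n. m \<ge> M' \<Longrightarrow> n \<ge> M' \<Longrightarrow> sdist (e m) (e n) < \<epsilon> / (2 * C)"
      using cauchy_seqD[OF assms(1)] cauchy_seqD[OF assms(2)] by metis
    show "\<exists>N. \<forall>m\<ge>N. \<forall>n\<ge>N. norm (B (d m) (e m) - B (d n) (e n)) < \<epsilon>"
    proof (intro exI[of _ "max M M'"] allI impI)
      fix m n assume mn: "max M M' \<le> m" "max M M' \<le> n"
      have "norm (B (d m) (e m) - B (d n) (e n))
          \<le> sdist (d m) (d n) * seminorm (e m) + seminorm (d n) * sdist (e m) (e n)"
        by (intro B_diff_le) auto
      also have "\<dots> \<le> sdist (d m) (d n) * C' + C * sdist (e m) (e n)"
        using C C' by (intro add_mono mult_left_mono mult_right_mono) auto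
      also have "\<dots> < \<epsilon> / (2 * C') * C' + C * (\<epsilon> / (2 * C))"
        using C C' mn M[of m n] M'[of m n]
          by (intro add_strict_mono mult_strict_left_mono mult_strict_right_mono) auto
      also have "\<dots> = \<epsilon>" using C C' by simp
      finally show "norm (B (d m) (e m) - B (d n) (e n)) < \<epsilon>" .
    qed
  qed
  then show ?thesis by (simp add: Cauchy_convergent_iff)
qed

lemma cauchy_seq_const: "d \<in> S \<Longrightarrow> cauchy_seq (\<lambda>n. d)"
  by (auto simp: cauchy_seq_def sdist_def seminorm_def)

lemma cauchy_seq_add:
  assumes "cauchy_seq d" "cauchy_seq e"
  shows "cauchy_seq (\<lambda>n. add (d n) (e n))"
  unfolding cauchy_seq_def
proof (intro conjI allI impI)
  note [simp] = cauchy_seq_in[OF assms(1)] cauchy_seq_in[OF assms(2)]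
  show "range (\<lambda>n. add (d n) (e n)) \<subseteq> S" by auto
  fix \<epsilon> :: real assume "0 < \<epsilon>"
  then have "0 < \<epsilon> / 2" by simp
  then obtain M M' where
    M: "\<And>m n. m \<ge> M \<Longrightarrow> n \<ge> M \<Longrightarrow> sdist (d m) (d n) < \<epsilon> / 2" and
    M': "\<And>m n. m \<ge> M' \<Longrightarrow> n \<ge> M' \<Longrightarrow> sdist (e m) (e n) < \<epsilon> / 2"
    using cauchy_seqD[OF assms(1)] cauchy_seqD[OF assms(2)] by metis
  show "\<exists>M. \<forall>m\<ge>M. \<forall>n\<ge>M. sdist (add (d m) (e m)) (add (d n) (e n)) < \<epsilon>"
  proof (intro exI[of _ "max M M'"] allI impI)
    fix m n assume mn: "max M M' \<le> m" "max M M' \<le> n"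
    show "sdist (add (d m) (e m)) (add (d n) (e n)) < \<epsilon>"
      using sdist_add_add[of "d m" "e m" "d n" "e n"] M[of m n] M'[of m n] mn by simp
  qed
qed

lemma cauchy_seq_lipschitz:
  assumes "cauchy_seq d" and "\<And>n. e n \<in> S"
    and le: "\<And>m n. sdist (e m) (e n) \<le> C * sdist (d m) (d n)"
  shows "cauchy_seq e"
  unfolding cauchy_seq_def
proof (intro conjI allI impI)
  show "range e \<subseteq> S" using assms(2) by auto
  fix \<epsilon> :: real assume "0 < \<epsilon>"
  then have "0 < \<epsilon> / (\<bar>C\<bar> + 1)" by simp
  then obtain M where M: "\<And>m n. m \<ge> M \<Longrightarrow> n \<ge> M \<Longrightarrow> sdist (d m) (d n) < \<epsilon> / (\<bar>C\<bar> + 1)"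
    using cauchy_seqD[OF assms(1)] by metis
  show "\<exists>M. \<forall>m\<ge>M. \<forall>n\<ge>M. sdist (e m) (e n) < \<epsilon>"
  proof (intro exI[of _ M] allI impI)
    fix m n assume mn: "M \<le> m" "M \<le> n"
    have "sdist (e m) (e n) \<le> C * sdist (d m) (d n)" by (rule le)
    also have "\<dots> \<le> (\<bar>C\<bar> + 1) * sdist (d m) (d n)"
      using assms(1) by (intro mult_right_mono) (auto simp: cauchy_seq_in)
    also have "\<dots> < \<epsilon>" using M[OF mn] by (simp add: field_simps)
    finally show "sdist (e m) (e n) < \<epsilon>" .
  qed
qed

lemma cauchy_seq_scale: "cauchy_seq d \<Longrightarrow> cauchy_seq (\<lambda>n. scale c (d n))"
  by (rule cauchy_seq_lipschitz[where C = "cmod c"]) (auto simp: cauchy_seq_in sdist_scale_scale)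

end

section \<open>Separation of vectors and adjoints in a Hilbert space\<close>

lemma hilbert_space_semi_inner:
  assumes "hilbert_space H"
  shows "semi_inner (hcarrier H) (hadd H) (hscale H) (hinner H)"
proof -
  interpret hilbert_space H by fact
  show ?thesis
  proof
    fix d e f c assume de: "d \<in> hcarrier H" "e \<in> hcarrier H"
    show "hinner H d (hscale H c e) = cnj c * hinner H d e"
      using de inner_commute[of d "hscale H c e"] inner_commute[of d e]
      by (simp add: scale_closed inner_scale_left)
    assume "f \<in> hcarrier H"
    then show "hinner H d (hadd H e f) = hinner H d e + hinner H d f"
      using de inner_commute[of d "hadd H e f"] inner_commute[of d e] inner_commute[of d f]
      by (simp add: add_closed inner_add_left)
  qed (auto intro: add_closed scale_closed inner_add_left inner_scale_left inner_nonneg)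
qed

context hilbert_space
begin

lemma eq_if_inner_eq:
  assumes "\<xi> \<in> hcarrier H" "\<eta> \<in> hcarrier H"
    and eq: "\<And>\<zeta>. \<zeta> \<in> hcarrier H \<Longrightarrow> hinner H \<zeta> \<xi> = hinner H \<zeta> \<eta>"
  shows "\<xi> = \<eta>"
proof -
  interpret semi_inner "hcarrier H" "hadd H" "hscale H" "hinner H"
    by (rule hilbert_space_semi_inner) unfold_locales
  let ?\<eta>' = "hscale H (- 1) \<eta>"
  have "hadd H \<xi> ?\<eta>' = hzero H"
    using assms(1,2) eq[of \<xi>] eq[of \<eta>] by (intro inner_definite) simp_all
  \<comment> \<open>Definiteness identifies the multiple of \<eta> by 0 with the zero vector, so
    \<open>?\<eta>'\<close> is the additive inverse of \<eta>.\<close>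
  moreover have "hadd H ?\<eta>' \<eta> = hzero H"
  proof -
    have "hadd H ?\<eta>' \<eta> = hscale H (- 1 + 1) \<eta>"
      unfolding scale_add_left[OF assms(2)] using assms(2) by (simp add: scale_one)
    also have "\<dots> = hzero H"
      using assms(2) by (intro inner_definite) simp_all
    finally show ?thesis .
  qed
  ultimately show ?thesis
    using assms(1,2) add_assoc[of \<xi> ?\<eta>' \<eta>] add_zero[of \<xi>] add_zero[of \<eta>] add_commute[of \<eta> "hzero H"]
    by (simp add: zero_closed)
qed

text \<open>Inner products separate vectors of the carrier, so a vector that satisfies the
  description in \<open>adj_op\<close> is the one it selects.\<close>

lemma adj_op_eqI:
  assumes "\<zeta> \<in> hcarrier H" "\<And>\<xi>. \<xi> \<in> hcarrier H \<Longrightarrow> hinner K (T \<xi>) \<eta> = hinner H \<xi> \<zeta>"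
  shows "adj_op H K T \<eta> = \<zeta>"
  unfolding adj_op_def using assms by (intro the_equality) (auto intro: eq_if_inner_eq)

end

section \<open>Reproducing kernel Hilbert spaces\<close>

text \<open>A list stands for the formal sum of its entries. It carries no coefficients, because a
  scalar multiple of a generator will again be a generator.\<close>

definition gram :: "('z \<Rightarrow> 'z \<Rightarrow> complex) \<Rightarrow> 'z list \<Rightarrow> 'z list \<Rightarrow> complex" where
  "gram k d e = (\<Sum>p\<leftarrow>d. \<Sum>q\<leftarrow>e. k p q)"

lemma gram_Nil_left [simp]: "gram k [] e = 0"
  and gram_Cons_left: "gram k (p # d) e = (\<Sum>q\<leftarrow>e. k p q) + gram k d e"
  and gram_append_left [simp]: "gram k (d @ d') e = gram k d e + gram k d' e"
  by (simp_all add: gram_def)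

lemma gram_Nil_right [simp]: "gram k d [] = 0"
  and gram_Cons_right: "gram k d (q # e) = (\<Sum>p\<leftarrow>d. k p q) + gram k d e"
  and gram_append_right [simp]: "gram k d (e @ e') = gram k d e + gram k d e'"
  by (simp_all add: gram_def sum_list_addf)

lemma gram_conv_left: "gram k d e = (\<Sum>p\<leftarrow>d. gram k [p] e)"
  by (simp add: gram_def)

lemma gram_conv_right: "gram k d e = (\<Sum>q\<leftarrow>e. gram k d [q])"
  by (induction e) (simp_all add: gram_Cons_right)

lemma gram_concat_map_left: "gram k (concat (map T d)) e = (\<Sum>p\<leftarrow>d. gram k (T p) e)"
  by (induction d) simp_all

lemma gram_concat_map_right: "gram k d (concat (map T e)) = (\<Sum>q\<leftarrow>e. gram k d (T q))"
  by (induction e) simp_all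

text \<open>Adjointness on generators spreads to formal sums by biadditivity.\<close>

lemma gram_adjoint:
  assumes "\<And>p q. gram k (T p) [q] = gram k [p] (T' q)"
  shows "gram k (concat (map T d)) e = gram k d (concat (map T' e))"
proof -
  have "gram k (T p) e = gram k [p] (concat (map T' e))" for p
    by (subst gram_conv_right) (simp add: gram_concat_map_right assms)
  then have "gram k (concat (map T d)) e = (\<Sum>p\<leftarrow>d. gram k [p] (concat (map T' e)))"
    by (simp add: gram_concat_map_left)
  then show ?thesis
    by (subst (asm) gram_conv_left[symmetric])
qed

locale kernel =
  fixes k :: "'z \<Rightarrow> 'z \<Rightarrow> complex" and sc :: "complex \<Rightarrow> 'z \<Rightarrow> 'z"
  assumes k_sc_left [simp]: "k (sc c p) q = c * k p q"
    and k_sc_right [simp]: "k p (sc c q) = cnj c * k p q"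
    and gram_nonneg: "gram k d d \<in> \<real>\<^sub>\<ge>\<^sub>0"
begin

lemma gram_map_sc_left [simp]: "gram k (map (sc c) d) e = c * gram k d e"
proof -
  have "k (sc c p) = (\<lambda>q. c * k p q)" for p by (simp add: fun_eq_iff)
  then show ?thesis by (simp add: gram_def o_def sum_list_const_mult)
qed

lemma gram_map_sc_right [simp]: "gram k d (map (sc c) e) = cnj c * gram k d e"
  by (simp add: gram_def o_def sum_list_const_mult)

sublocale L: semi_inner UNIV "(@)" "\<lambda>c. map (sc c)" "gram k"
  by unfold_locales (simp_all add: gram_nonneg)

text \<open>The reproducing kernel Hilbert space of \<open>k\<close> consists of the functions represented by
  Cauchy sequences of formal combinations of the points.\<close>

definition represents :: "(nat \<Rightarrow> 'z list) \<Rightarrow> ('z \<Rightarrow> complex) \<Rightarrow> bool" where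
  "represents d F \<longleftrightarrow> L.cauchy_seq d \<and> (\<forall>z. (\<lambda>n. gram k (d n) [z]) \<longlonglongrightarrow> F z)"

text \<open>A formal sum becomes the function of its inner products with the points; formal sums
  that differ by a null vector have the same image.\<close>

definition embed :: "'z list \<Rightarrow> 'z \<Rightarrow> complex" where "embed d z = gram k d [z]"

text \<open>The representing sequences are chosen arbitrarily; \<open>represents_inner\<close> shows
  that the limit does not depend on the choice.\<close>

definition rk_inner :: "('z \<Rightarrow> complex) \<Rightarrow> ('z \<Rightarrow> complex) \<Rightarrow> complex" where
  "rk_inner F G =
     lim (\<lambda>n. gram k ((SOME d. represents d F) n) ((SOME e. represents e G) n))"

definition rk_space :: "('z \<Rightarrow> complex) hilbert" where
  "rk_space = \<lparr>hcarrier = {F. \<exists>d. represents d F}, hadd = (\<lambda>F G z. F z + G z),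
     hzero = (\<lambda>_. 0), hscale = (\<lambda>c F z. c * F z), hinner = rk_inner\<rparr>"

lemma rk_space_simps [simp]:
  "hadd rk_space = (\<lambda>F G z. F z + G z)" "hzero rk_space = (\<lambda>_. 0)"
  "hscale rk_space = (\<lambda>c F z. c * F z)" "hinner rk_space = rk_inner"
  by (simp_all add: rk_space_def)

lemma in_rk_space_iff: "F \<in> hcarrier rk_space \<longleftrightarrow> (\<exists>d. represents d F)"
  by (simp add: rk_space_def)

lemma represents_in [intro]: "represents d F \<Longrightarrow> F \<in> hcarrier rk_space"
  by (auto simp: in_rk_space_iff)

lemma represents_cauchy: "represents d F \<Longrightarrow> L.cauchy_seq d"
  by (simp add: represents_def)

lemma represents_tendsto: "represents d F \<Longrightarrow> (\<lambda>n. gram k (d n) [z]) \<longlonglongrightarrow> F z"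
  by (simp add: represents_def)

lemma represents_tendsto_list:
  assumes "represents d F"
  shows "(\<lambda>n. gram k (d n) e) \<longlonglongrightarrow> (\<Sum>z\<leftarrow>e. F z)"
proof (induction e)
  case (Cons z e)
  have "(\<lambda>n. gram k (d n) [z] + gram k (d n) e) \<longlonglongrightarrow> F z + (\<Sum>z\<leftarrow>e. F z)"
    by (intro tendsto_add Cons.IH represents_tendsto assms)
  then show ?case by (simp add: gram_Cons_right)
qed simp

text \<open>Reduces equations between functions in the completion to computations with formal sums
  modulo null vectors.\<close>

lemma represents_unique:
  assumes "represents d F" "represents e G"
    and "\<And>n z. gram k (d n) [z] = gram k (e n) [z]"
  shows "F = G"
proof
  fix z
  show "F z = G z"
    using LIMSEQ_unique[OF represents_tendsto[OF assms(1)], of z "G z"]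
      represents_tendsto[OF assms(2), of z] by (simp add: assms(3))
qed

lemma represents_embed: "represents (\<lambda>n. d) (embed d)"
  by (simp add: represents_def embed_def L.cauchy_seq_const)

lemma represents_add:
  "\<lbrakk>represents d F; represents e G\<rbrakk> \<Longrightarrow> represents (\<lambda>n. d n @ e n) (\<lambda>z. F z + G z)"
  by (auto simp: represents_def intro: L.cauchy_seq_add tendsto_add)

lemma represents_scale: "represents d F \<Longrightarrow> represents (\<lambda>n. map (sc c) (d n)) (\<lambda>z. c * F z)"
  by (auto simp: represents_def intro: L.cauchy_seq_scale tendsto_mult)

lemma represents_zero: "represents (\<lambda>n. []) (\<lambda>_. 0)"
  using represents_embed[of "[]"] by (simp add: embed_def[abs_def])

text \<open>For fixed M, \<open>gram k (g n) (g M)\<close> tends to 0, because \<open>g M\<close> is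
  a finite sum of points. The Cauchy property makes the distance of \<open>g n\<close> and
  \<open>g M\<close> small, so the limit of \<open>gram k (g n) (g n)\<close> is arbitrarily
  small.\<close>

lemma represents_zero_tendsto:
  assumes g: "represents g (\<lambda>_. 0)"
  shows "(\<lambda>n. L.seminorm (g n)) \<longlonglongrightarrow> 0"
proof -
  note cau = represents_cauchy[OF g]
  obtain C where C: "0 < C" "\<And>n. L.seminorm (g n) \<le> C" using L.cauchy_seq_bounded[OF cau] by blast
  obtain l where l: "(\<lambda>n. gram k (g n) (g n)) \<longlonglongrightarrow> l"
    using L.convergent_B[OF cau cau] by (auto simp: convergent_def)
  have "cmod l \<le> \<epsilon>" if "0 < \<epsilon>" for \<epsilon> :: real
  proof -
    have "0 < \<epsilon> / C" using C that by simp
    then obtain M where M: "\<And>m n. m \<ge> M \<Longrightarrow> n \<ge> M \<Longrightarrow> L.sdist (g m) (g n) < \<epsilon> / C"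
      using L.cauchy_seqD[OF cau] by metis
    have "(\<lambda>n. gram k (g n) (g n) - gram k (g n) (g M)) \<longlonglongrightarrow> l - (\<Sum>z\<leftarrow>g M. 0)"
      by (intro tendsto_diff l represents_tendsto_list[OF g])
    then have "(\<lambda>n. cmod (gram k (g n) (g n) - gram k (g n) (g M))) \<longlonglongrightarrow> cmod l"
      by (intro tendsto_norm) simp
    moreover have "eventually (\<lambda>n. cmod (gram k (g n) (g n) - gram k (g n) (g M)) \<le> \<epsilon>) sequentially"
    proof (rule eventually_sequentiallyI[of M])
      fix n assume n: "M \<le> n"
      have "cmod (gram k (g n) (g n) - gram k (g n) (g M))
          \<le> L.sdist (g n) (g n) * L.seminorm (g n) + L.seminorm (g n) * L.sdist (g n) (g M)"
        by (intro L.B_diff_le) auto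
      also have "\<dots> \<le> C * (\<epsilon> / C)"
      proof -
        have "L.sdist (g n) (g n) = 0" by (simp add: L.sdist_def L.seminorm_def)
        moreover have "L.seminorm (g n) * L.sdist (g n) (g M) \<le> C * (\<epsilon> / C)"
          using C M[of n M] n by (intro mult_mono) (auto simp: less_imp_le)
        ultimately show ?thesis by simp
      qed
      finally show "cmod (gram k (g n) (g n) - gram k (g n) (g M)) \<le> \<epsilon>" using C by simp
    qed
    ultimately show ?thesis by (rule tendsto_upperbound) simp
  qed
  then have "cmod l \<le> 0" by (rule field_le_epsilon) simp
  then have "(\<lambda>n. sqrt (Re (gram k (g n) (g n)))) \<longlonglongrightarrow> sqrt (Re 0)"
    using l by (intro tendsto_real_sqrt tendsto_Re) simp
  then show ?thesis by (simp add: L.seminorm_def)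
qed

lemma sdist_represents_tendsto:
  assumes "represents d F" "represents d' F"
  shows "(\<lambda>n. L.sdist (d n) (d' n)) \<longlonglongrightarrow> 0"
  unfolding L.sdist_def
  using represents_add[OF assms(1) represents_scale[OF assms(2), of "-1"]]
  by (intro represents_zero_tendsto) simp

lemma represents_inner:
  assumes "represents d F" "represents e G"
  shows "(\<lambda>n. gram k (d n) (e n)) \<longlonglongrightarrow> rk_inner F G"
proof -
  define d' e' where "d' = (SOME d. represents d F)" and "e' = (SOME e. represents e G)"
  have d': "represents d' F" and e': "represents e' G"
    unfolding d'_def e'_def
    by (rule someI[of "\<lambda>d. represents d F", OF assms(1)],
        rule someI[of "\<lambda>e. represents e G", OF assms(2)])
  obtain C where C: "0 < C" "\<And>n. L.seminorm (d' n) \<le> C"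
    using L.cauchy_seq_bounded[OF represents_cauchy[OF d']] by blast
  obtain C' where C': "0 < C'" "\<And>n. L.seminorm (e n) \<le> C'"
    using L.cauchy_seq_bounded[OF represents_cauchy[OF assms(2)]] by blast
  have "(\<lambda>n. gram k (d' n) (e' n)) \<longlonglongrightarrow> rk_inner F G"
    using L.convergent_B[OF represents_cauchy[OF d'] represents_cauchy[OF e']]
    by (simp add: rk_inner_def d'_def e'_def convergent_LIMSEQ_iff)
  moreover have "(\<lambda>n. gram k (d n) (e n) - gram k (d' n) (e' n)) \<longlonglongrightarrow> 0"
  proof (rule Lim_null_comparison)
    show "eventually (\<lambda>n. norm (gram k (d n) (e n) - gram k (d' n) (e' n))
        \<le> L.sdist (d n) (d' n) * C' + C * L.sdist (e n) (e' n)) sequentially"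
      using C C' by (intro always_eventually allI order_trans[OF L.B_diff_le]
          add_mono mult_left_mono mult_right_mono) (auto simp: less_imp_le)
    have "(\<lambda>n. L.sdist (d n) (d' n) * C' + C * L.sdist (e n) (e' n)) \<longlonglongrightarrow> 0 * C' + C * 0"
      using assms d' e' by (intro tendsto_intros sdist_represents_tendsto)
    then show "(\<lambda>n. L.sdist (d n) (d' n) * C' + C * L.sdist (e n) (e' n)) \<longlonglongrightarrow> 0" by simp
  qed
  ultimately have "(\<lambda>n. gram k (d' n) (e' n) + (gram k (d n) (e n) - gram k (d' n) (e' n)))
      \<longlonglongrightarrow> rk_inner F G + 0"
    by (rule tendsto_add)
  then show ?thesis by simp
qed

lemma rk_inner_embed [simp]: "rk_inner (embed d) (embed e) = gram k d e"
  by (rule LIMSEQ_unique[OF represents_inner[OF represents_embed represents_embed] tendsto_const])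

text \<open>Each law holds for \<open>gram k\<close> along representing sequences and passes to the
  limit.\<close>

sublocale R: semi_inner "hcarrier rk_space" "\<lambda>F G z. F z + G z" "\<lambda>c F z. c * F z" rk_inner
proof
  fix F G f :: "'z \<Rightarrow> complex" and c
  assume F: "F \<in> hcarrier rk_space"
  then obtain d where d: "represents d F" by (auto simp: in_rk_space_iff)
  show "(\<lambda>z. c * F z) \<in> hcarrier rk_space"
    using represents_scale[OF d] by auto
  have "(\<lambda>n. Re (gram k (d n) (d n))) \<longlonglongrightarrow> Re (rk_inner F F)"
    and "(\<lambda>n. Im (gram k (d n) (d n))) \<longlonglongrightarrow> Im (rk_inner F F)"
    using represents_inner[OF d d] by (auto intro: tendsto_intros)
  then have "0 \<le> Re (rk_inner F F)" "Im (rk_inner F F) = 0"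
    by (auto intro: tendsto_lowerbound simp: L.Re_B_self_nonneg L.Im_B_self LIMSEQ_const_iff)
  then show "rk_inner F F \<in> \<real>\<^sub>\<ge>\<^sub>0" by (simp add: complex_nonneg_Reals_iff)
  assume G: "G \<in> hcarrier rk_space"
  then obtain e where e: "represents e G" by (auto simp: in_rk_space_iff)
  show "(\<lambda>z. F z + G z) \<in> hcarrier rk_space"
    using represents_add[OF d e] by auto
  have "(\<lambda>n. c * gram k (d n) (e n)) \<longlonglongrightarrow> rk_inner (\<lambda>z. c * F z) G"
    using represents_inner[OF represents_scale[OF d, of c] e] by simp
  moreover have "(\<lambda>n. c * gram k (d n) (e n)) \<longlonglongrightarrow> c * rk_inner F G"
    by (intro tendsto_intros represents_inner d e)
  ultimately show "rk_inner (\<lambda>z. c * F z) G = c * rk_inner F G"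
    by (simp add: LIMSEQ_unique)
  have "(\<lambda>n. cnj c * gram k (d n) (e n)) \<longlonglongrightarrow> rk_inner F (\<lambda>z. c * G z)"
    using represents_inner[OF d represents_scale[OF e, of c]] by simp
  moreover have "(\<lambda>n. cnj c * gram k (d n) (e n)) \<longlonglongrightarrow> cnj c * rk_inner F G"
    by (intro tendsto_intros represents_inner d e)
  ultimately show "rk_inner F (\<lambda>z. c * G z) = cnj c * rk_inner F G"
    by (simp add: LIMSEQ_unique)
  assume "f \<in> hcarrier rk_space"
  then obtain h where h: "represents h f" by (auto simp: in_rk_space_iff)
  have "(\<lambda>n. gram k (d n) (h n) + gram k (e n) (h n)) \<longlonglongrightarrow> rk_inner (\<lambda>z. F z + G z) f"
    using represents_inner[OF represents_add[OF d e] h] by simp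
  moreover have "(\<lambda>n. gram k (d n) (h n) + gram k (e n) (h n)) \<longlonglongrightarrow> rk_inner F f + rk_inner G f"
    by (intro tendsto_intros represents_inner d e h)
  ultimately show "rk_inner (\<lambda>z. F z + G z) f = rk_inner F f + rk_inner G f"
    by (simp add: LIMSEQ_unique)
  have "(\<lambda>n. gram k (d n) (e n) + gram k (d n) (h n)) \<longlonglongrightarrow> rk_inner F (\<lambda>z. G z + f z)"
    using represents_inner[OF d represents_add[OF e h]] by simp
  moreover have "(\<lambda>n. gram k (d n) (e n) + gram k (d n) (h n)) \<longlonglongrightarrow> rk_inner F G + rk_inner F f"
    by (intro tendsto_intros represents_inner d e h)
  ultimately show "rk_inner F (\<lambda>z. G z + f z) = rk_inner F G + rk_inner F f"
    by (simp add: LIMSEQ_unique)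
qed

section \<open>Norm, density of the formal sums and completeness\<close>

lemma hnorm_rk: "hnorm rk_space F = R.seminorm F"
  by (simp add: hnorm_def R.seminorm_def)

lemma hdist_rk: "\<lbrakk>F \<in> hcarrier rk_space; G \<in> hcarrier rk_space\<rbrakk> \<Longrightarrow> hdist rk_space F G = R.sdist F G"
  by (simp add: hdist_def R.sdist_def hnorm_rk)

lemma represents_norm:
  assumes "represents d F"
  shows "(\<lambda>n. L.seminorm (d n)) \<longlonglongrightarrow> R.seminorm F"
  unfolding L.seminorm_def R.seminorm_def
  using represents_inner[OF assms assms] by (auto intro!: tendsto_intros)

text \<open>Evaluation at z is the inner product with the point z, so this is Cauchy-Schwarz in the
  limit. It makes functions of norm zero vanish.\<close>

lemma cmod_rk_le:
  assumes "F \<in> hcarrier rk_space"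
  shows "cmod (F z) \<le> R.seminorm F * L.seminorm [z]"
proof -
  obtain d where d: "represents d F" using assms by (auto simp: in_rk_space_iff)
  show ?thesis
  proof (rule LIMSEQ_le)
    show "(\<lambda>n. cmod (gram k (d n) [z])) \<longlonglongrightarrow> cmod (F z)"
      by (intro tendsto_norm represents_tendsto d)
    show "(\<lambda>n. L.seminorm (d n) * L.seminorm [z]) \<longlonglongrightarrow> R.seminorm F * L.seminorm [z]"
      by (intro tendsto_intros represents_norm d)
  qed (auto intro: L.Cauchy_Schwarz)
qed

lemma rk_definite:
  assumes "F \<in> hcarrier rk_space" "rk_inner F F = 0"
  shows "F = (\<lambda>_. 0)"
  using cmod_rk_le[OF assms(1)] assms(2) by (auto simp: R.seminorm_def fun_eq_iff)

lemma embed_in [simp]: "embed d \<in> hcarrier rk_space"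
  using represents_embed by blast

lemma sdist_embed: "R.sdist (embed d) (embed e) = L.sdist d e"
proof -
  have "(\<lambda>z. embed d z + - 1 * embed e z) = embed (d @ map (sc (- 1)) e)"
    by (simp add: embed_def fun_eq_iff)
  then have "R.sdist (embed d) (embed e) = R.seminorm (embed (d @ map (sc (- 1)) e))"
    unfolding R.sdist_def by simp
  then show ?thesis
    by (simp add: L.sdist_def R.seminorm_def L.seminorm_def del: gram_append_left gram_append_right)
qed

text \<open>With m fixed, the differences of \<open>d n\<close> and \<open>d m\<close> represent
  \<open>F\<close> minus \<open>embed (d m)\<close>. Their seminorms converge to the distance and
  are bounded by the Cauchy property.\<close>

lemma represents_approx:
  assumes "represents d F"
  shows "(\<lambda>m. R.sdist F (embed (d m))) \<longlonglongrightarrow> 0"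
proof (rule LIMSEQ_I)
  fix r :: real assume "0 < r"
  then have "0 < r / 2" by simp
  then obtain M where M: "\<And>m n. m \<ge> M \<Longrightarrow> n \<ge> M \<Longrightarrow> L.sdist (d m) (d n) < r / 2"
    using L.cauchy_seqD[OF represents_cauchy[OF assms]] by metis
  have "R.sdist F (embed (d m)) < r" if m: "m \<ge> M" for m
  proof -
    have "represents (\<lambda>n. d n @ map (sc (- 1)) (d m)) (\<lambda>z. F z + - 1 * embed (d m) z)"
      by (intro represents_add represents_scale represents_embed assms)
    then have "(\<lambda>n. L.sdist (d n) (d m)) \<longlonglongrightarrow> R.sdist F (embed (d m))"
      unfolding L.sdist_def R.sdist_def by (drule_tac represents_norm) simp
    moreover have "eventually (\<lambda>n. L.sdist (d n) (d m) \<le> r / 2) sequentially"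
      by (rule eventually_sequentiallyI[of M]) (use M m in \<open>auto simp: less_imp_le\<close>)
    ultimately have "R.sdist F (embed (d m)) \<le> r / 2"
      by (rule tendsto_upperbound) simp
    then show ?thesis using \<open>0 < r\<close> by simp
  qed
  then show "\<exists>no. \<forall>n\<ge>no. norm (R.sdist F (embed (d n)) - 0) < r"
    using assms by (intro exI[of _ M]) (auto simp: represents_in)
qed

lemma Metric_space_rk: "Metric_space (hcarrier rk_space) (hdist rk_space)"
proof
  fix F G :: "'z \<Rightarrow> complex"
  show "0 \<le> hdist rk_space F G"
    by (cases "F \<in> hcarrier rk_space \<and> G \<in> hcarrier rk_space") (auto simp: hdist_rk, auto simp: hdist_def)
  show "hdist rk_space F G = hdist rk_space G F"
    by (cases "F \<in> hcarrier rk_space \<and> G \<in> hcarrier rk_space")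
      (auto simp: hdist_rk R.sdist_commute, auto simp: hdist_def)
  assume FG: "F \<in> hcarrier rk_space" "G \<in> hcarrier rk_space"
  have "F = G" if "R.sdist F G = 0"
  proof -
    have "(\<lambda>z. F z - G z) \<in> hcarrier rk_space" 
      using R.add_in[OF FG(1) R.scale_in[OF FG(2), of "-1"]] by simp
    then have "cmod (F z - G z) \<le> 0" for z
      using cmod_rk_le[of "\<lambda>z. F z - G z" z] that by (simp add: R.sdist_def[of F G])
    then show ?thesis by auto
  qed
  moreover have "R.sdist F F = 0"
    using rk_inner_embed[of "[]" "[]"]
    by (simp add: R.sdist_def R.seminorm_def embed_def[abs_def])
  ultimately show "hdist rk_space F G = 0 \<longleftrightarrow> F = G" using FG by (auto simp: hdist_rk)
next
  fix F G f :: "'z \<Rightarrow> complex"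
  assume "F \<in> hcarrier rk_space" "G \<in> hcarrier rk_space" "f \<in> hcarrier rk_space"
  then show "hdist rk_space F f \<le> hdist rk_space F G + hdist rk_space G f"
    by (simp add: hdist_rk R.sdist_triangle)
qed

text \<open>The n-th function is replaced by a formal sum at distance less than 1 / (n + 1). These
  formal sums are Cauchy, hence represent a function, which is the limit.\<close>

lemma rk_complete:
  assumes F: "\<And>n. F n \<in> hcarrier rk_space"
    and cauchy: "\<And>\<epsilon>. 0 < \<epsilon> \<Longrightarrow> \<exists>M. \<forall>m\<ge>M. \<forall>n\<ge>M. R.sdist (F m) (F n) < \<epsilon>"
  obtains G where "G \<in> hcarrier rk_space" "(\<lambda>n. R.sdist (F n) G) \<longlonglongrightarrow> 0"
proof -
  have "\<exists>e. R.sdist (F n) (embed e) < inverse (Suc n)" for n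
  proof -
    obtain d where d: "represents d (F n)" using F by (auto simp: in_rk_space_iff)
    have "eventually (\<lambda>m. R.sdist (F n) (embed (d m)) < inverse (Suc n)) sequentially"
      using represents_approx[OF d] by (rule order_tendstoD) simp
    then show ?thesis by (auto simp: eventually_sequentially)
  qed
  then obtain e where e: "\<And>n. R.sdist (F n) (embed (e n)) < inverse (Suc n)" by metis
  have e0: "(\<lambda>n. R.sdist (F n) (embed (e n))) \<longlonglongrightarrow> 0"
    by (rule tendsto_sandwich[OF _ _ tendsto_const LIMSEQ_inverse_real_of_nat])
      (auto simp del: of_nat_Suc simp: F intro!: always_eventually less_imp_le[OF e])
  have cau: "L.cauchy_seq e"
    unfolding L.cauchy_seq_def
  proof (intro conjI allI impI)
    fix \<epsilon> :: real assume "0 < \<epsilon>"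
    then have "0 < \<epsilon> / 3" by simp
    obtain M where M: "\<And>m n. m \<ge> M \<Longrightarrow> n \<ge> M \<Longrightarrow> R.sdist (F m) (F n) < \<epsilon> / 3"
      using cauchy[OF \<open>0 < \<epsilon> / 3\<close>] by auto
    obtain M' where M': "\<And>n. n \<ge> M' \<Longrightarrow> R.sdist (F n) (embed (e n)) < \<epsilon> / 3"
      using order_tendstoD(2)[OF e0 \<open>0 < \<epsilon> / 3\<close>] by (auto simp: eventually_sequentially)
    show "\<exists>M. \<forall>m\<ge>M. \<forall>n\<ge>M. L.sdist (e m) (e n) < \<epsilon>"
    proof (intro exI[of _ "max M M'"] allI impI)
      fix m n assume mn: "max M M' \<le> m" "max M M' \<le> n"
      have "R.sdist (embed (e m)) (embed (e n))
          \<le> R.sdist (embed (e m)) (F m) + (R.sdist (F m) (F n) + R.sdist (F n) (embed (e n)))"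
        using R.sdist_triangle[of "embed (e m)" "F m" "embed (e n)"]
          R.sdist_triangle[of "F m" "F n" "embed (e n)"] F by simp
      also have "R.sdist (embed (e m)) (F m) = R.sdist (F m) (embed (e m))"
        by (simp add: F R.sdist_commute)
      finally show "L.sdist (e m) (e n) < \<epsilon>"
        using M[of m n] M'[of m] M'[of n] mn by (simp add: sdist_embed)
    qed
  qed auto
  define G where "G z = lim (\<lambda>n. gram k (e n) [z])" for z
  have G: "represents e G"
    unfolding represents_def G_def
    using L.convergent_B[OF cau L.cauchy_seq_const] cau by (simp add: convergent_LIMSEQ_iff)
  have "(\<lambda>n. R.sdist (F n) (embed (e n)) + R.sdist G (embed (e n))) \<longlonglongrightarrow> 0 + 0"
    by (intro tendsto_add e0 represents_approx G)
  then have to0: "(\<lambda>n. R.sdist (F n) (embed (e n)) + R.sdist G (embed (e n))) \<longlonglongrightarrow> 0" by simp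
  moreover have "R.sdist (F n) G \<le> R.sdist (F n) (embed (e n)) + R.sdist G (embed (e n))" for n
    using R.sdist_triangle[of "F n" "embed (e n)" G] R.sdist_commute[of G "embed (e n)"] F G
    by (auto simp: represents_in)
  moreover have "0 \<le> R.sdist (F n) G" for n
    using F represents_in[OF G] by (intro R.sdist_nonneg)
  ultimately have "(\<lambda>n. R.sdist (F n) G) \<longlonglongrightarrow> 0"
    by (intro Lim_null_comparison[OF always_eventually to0]) auto
  then show ?thesis using that G by blast
qed

theorem hilbert_space_rk: "hilbert_space rk_space"
proof
  fix F :: "'z \<Rightarrow> complex"
  show "\<exists>G\<in>hcarrier rk_space. hadd rk_space F G = hzero rk_space" if "F \<in> hcarrier rk_space"
    using R.scale_in[OF that, of "-1"] by (intro bexI[of _ "\<lambda>z. - F z"]) auto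
  show "F \<in> hcarrier rk_space \<Longrightarrow> hinner rk_space F F = 0 \<Longrightarrow> F = hzero rk_space"
    using rk_definite by simp
  show "hinner rk_space F G = cnj (hinner rk_space G F)"
    if "F \<in> hcarrier rk_space" "G \<in> hcarrier rk_space" for G
    using R.B_hermitian[of F G] that by simp
  interpret M: Metric_space "hcarrier rk_space" "hdist rk_space" by (rule Metric_space_rk)
  show "M.mcomplete"
    unfolding M.mcomplete_def
  proof (intro allI impI)
    fix \<sigma> assume \<sigma>: "M.MCauchy \<sigma>"
    then have in_K: "\<sigma> n \<in> hcarrier rk_space" for n by (auto simp: M.MCauchy_def)
    have "\<exists>M. \<forall>m\<ge>M. \<forall>n\<ge>M. R.sdist (\<sigma> m) (\<sigma> n) < \<epsilon>" if "0 < \<epsilon>" for \<epsilon>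
      using \<sigma> that unfolding M.MCauchy_def by (simp add: hdist_rk in_K)
    with in_K obtain G where "G \<in> hcarrier rk_space" "(\<lambda>n. R.sdist (\<sigma> n) G) \<longlonglongrightarrow> 0"
      by (rule rk_complete)
    then show "\<exists>G. limitin M.mtopology \<sigma> G sequentially"
      by (intro exI[of _ G]) (simp add: M.limit_metric_sequentially in_K hdist_rk LIMSEQ_iff)
  qed
qed (use represents_zero in \<open>auto simp: algebra_simps R.B_nonneg\<close>)

end

section \<open>Square roots in C*-algebras\<close>

lemma norm_star: "norm (star x) = norm (x :: 'a :: unital_cstar_algebra)"
proof -
  have le: "norm y \<le> norm (star y)" for y :: 'a
  proof (cases "y = 0")
    case False
    have "norm y * norm y \<le> norm (star y) * norm y"
      using cstar_identity[of y] norm_mult_ineq[of "star y" y] by (simp add: power2_eq_square)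
    then show ?thesis using False by simp
  qed simp
  show ?thesis using le[of x] le[of "star x"] by (simp add: star_star)
qed

lemma bounded_linear_star: "bounded_linear (star :: 'a :: unital_cstar_algebra \<Rightarrow> 'a)"
  by (rule bounded_linear_intro[where K = 1]) (simp_all add: star_add scaleR_scaleC star_scaleC norm_star)

lemma star_one [simp]: "star 1 = (1 :: 'a :: unital_cstar_algebra)"
  using star_mult[of "star 1" "1 :: 'a"] by (simp add: star_star)

lemma star_power: "star (x ^ n) = star x ^ n" for x :: "'a :: unital_cstar_algebra"
  by (induction n) (simp_all add: star_mult power_commutes)

lemma norm_power_le: "norm (x ^ n) \<le> norm (1 :: 'a) * norm x ^ n" for x :: "'a :: unital_cstar_algebra"
proof (induction n)
  case (Suc n)
  have "norm (x ^ Suc n) \<le> norm x * norm (x ^ n)" by (simp add: norm_mult_ineq)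
  also have "\<dots> \<le> norm x * (norm (1 :: 'a) * norm x ^ n)" by (intro mult_left_mono Suc) auto
  finally show ?case by (simp add: mult_ac)
qed simp

text \<open>Passing from n to n + 1 multiplies the coefficient by (1/2 - n) / (n + 1), of modulus at
  most 1. The bound lets a geometric series dominate the binomial series.\<close>

lemma abs_gbinomial_half_le_1: "\<bar>(1 / 2 :: real) gchoose n\<bar> \<le> 1"
proof (induction n)
  case (Suc n)
  have "real (Suc n) * ((1 / 2) gchoose Suc n) = (1 / 2 - real n) * ((1 / 2) gchoose n)"
    using gbinomial_mult_1[of "1 / 2 :: real" n] by (simp add: algebra_simps)
  then have "real (Suc n) * \<bar>(1 / 2 :: real) gchoose Suc n\<bar> = \<bar>1 / 2 - real n\<bar> * \<bar>(1 / 2) gchoose n\<bar>"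
    by (metis abs_mult abs_of_nat)
  also have "\<dots> \<le> real (Suc n) * 1"
    using Suc by (intro mult_mono) auto
  finally show ?case
    by (simp only: mult_le_cancel_left)
qed simp

text \<open>The root is the binomial series of exponent \<open>1 / 2\<close>.\<close>

lemma self_adjoint_sqrt_one_minus:
  fixes a :: "'a :: unital_cstar_algebra"
  assumes a: "star a = a" and norm: "norm a < 1"
  obtains b where "star b = b" "b * b = 1 - a"
proof -
  define c where "c n = (- 1) ^ n * ((1 / 2 :: real) gchoose n)" for n
  define f where "f n = c n *\<^sub>R a ^ n" for n
  have le: "norm (norm (f n)) \<le> norm (1 :: 'a) * norm a ^ n" for n
    using mult_mono[OF abs_gbinomial_half_le_1[of n] norm_power_le[of a n]]
    by (simp add: f_def c_def abs_mult power_abs)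
  have "summable (\<lambda>n. norm (1 :: 'a) * norm a ^ n)"
    using norm by (simp add: summable_mult summable_geometric)
  then have summ: "summable (\<lambda>n. norm (f n))"
    by (rule summable_comparison_test') (rule le)
  have f_star: "star (f n) = f n" for n
    using bounded_linear.linear[OF bounded_linear_star, THEN linear_cmul, of "c n" "a ^ n"] a
    by (simp add: f_def star_power)
  \<comment> \<open>Vandermonde's identity turns the coefficients of the Cauchy square into those of
    exponent 1/2 + 1/2 = 1.\<close>
  have coeff: "(\<Sum>i\<le>n. f i * f (n - i)) = ((- 1) ^ n * ((1 :: real) gchoose n)) *\<^sub>R a ^ n" for n
  proof -
    have "f i * f (n - i) = ((- 1) ^ n * (((1 / 2) gchoose i) * ((1 / 2) gchoose (n - i)))) *\<^sub>R a ^ n"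
      if "i \<le> n" for i
    proof -
      have "(- 1) ^ i * (- 1 :: real) ^ (n - i) = (- 1) ^ n" "a ^ i * a ^ (n - i) = a ^ n"
        using that by (simp_all flip: power_add)
      moreover have "c i * c (n - i) =
          ((- 1) ^ i * (- 1) ^ (n - i)) * (((1 / 2) gchoose i) * ((1 / 2) gchoose (n - i)))"
        by (simp add: c_def mult_ac)
      ultimately show ?thesis by (simp add: f_def mult.commute[of "c (n - i)"])
    qed
    then have "(\<Sum>i\<le>n. f i * f (n - i))
        = ((- 1) ^ n * (\<Sum>i\<le>n. ((1 / 2) gchoose i) * ((1 / 2) gchoose (n - i)))) *\<^sub>R a ^ n"
      by (simp add: sum_distrib_left scaleR_sum_left)
    also have "(\<Sum>i\<le>n. ((1 / 2 :: real) gchoose i) * ((1 / 2) gchoose (n - i))) = 1 gchoose n"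
      using gbinomial_Vandermonde[of "1 / 2 :: real" "1 / 2" n] by (simp add: atMost_atLeast0)
    finally show ?thesis .
  qed
  \<comment> \<open>The coefficients of exponent 1 vanish from degree 2 on, which leaves 1 -
    a.\<close>
  have "(\<lambda>n. ((- 1) ^ n * ((1 :: real) gchoose n)) *\<^sub>R a ^ n) sums
      (\<Sum>n\<in>{0, 1}. ((- 1) ^ n * ((1 :: real) gchoose n)) *\<^sub>R a ^ n)"
  proof (rule sums_finite)
    fix n :: nat assume "n \<notin> {0, 1}"
    then have "1 < n" by auto
    then have "(1 :: real) gchoose n = 0"
      using binomial_gbinomial[of 1 n, where ?'a = real] by (simp add: binomial_eq_0)
    then show "((- 1) ^ n * ((1 :: real) gchoose n)) *\<^sub>R a ^ n = 0" by simp
  qed simp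
  then have "(\<lambda>n. \<Sum>i\<le>n. f i * f (n - i)) sums (1 - a)"
    by (simp add: coeff)
  then have "suminf f * suminf f = 1 - a"
    using Cauchy_product_sums[OF summ summ] sums_unique2 by blast
  moreover have "star (suminf f) = suminf f"
    using bounded_linear.suminf[OF bounded_linear_star summable_norm_cancel[OF summ]] by (simp add: f_star)
  ultimately show ?thesis using that by blast
qed

text \<open>Dividing by the square of \<open>norm u + 1\<close> gives the scaled term norm less than
  1, so that its difference from 1 has a self-adjoint square root b. The decomposition serves to
  bound representations.\<close>

lemma one_eq_positive_plus_scaled:
  fixes u :: "'a :: unital_cstar_algebra"
  obtains b where
    "1 = star b * b + complex_of_real (1 / (norm u + 1)\<^sup>2) *\<^sub>C (star u * u)"
proof -
  let ?a = "complex_of_real (1 / (norm u + 1)\<^sup>2) *\<^sub>C (star u * u)"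
  have "norm ?a = (norm u)\<^sup>2 / (norm u + 1)\<^sup>2"
    unfolding norm_scaleC cstar_identity norm_of_real by simp
  also have "\<dots> < 1"
    using power_strict_mono[of "norm u" "norm u + 1" 2] by (simp add: divide_less_eq)
  finally have "norm ?a < 1" .
  moreover have "star ?a = ?a" by (simp add: star_scaleC star_mult star_star)
  ultimately obtain b where "star b = b" "b * b = 1 - ?a"
    using self_adjoint_sqrt_one_minus[of ?a] by blast
  then show ?thesis using that[of b] by simp
qed

section \<open>Representations on reproducing kernel Hilbert spaces\<close>

lemma gram_concat_map_cong:
  assumes "\<And>p q. gram k (T p) [q] = gram k (T' p) [q]"
  shows "gram k (concat (map T d)) e = gram k (concat (map T' d)) e"
  unfolding gram_concat_map_left
  using assms by (subst (1 2) gram_conv_right) simp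

lemma concat_map_concat_map:
  "concat (map (\<lambda>p. concat (map T (T' p))) d) = concat (map T (concat (map T' d)))"
  by (induction d) simp_all

text \<open>The laws of a star representation are imposed after pairing with generators, that is
  modulo null vectors, because the lists themselves need not agree.\<close>

locale kernel_rep = kernel k sc
  for k :: "'z \<Rightarrow> 'z \<Rightarrow> complex" and sc +
  fixes \<tau> :: "'a :: unital_cstar_algebra \<Rightarrow> 'z \<Rightarrow> 'z list"
  assumes \<tau>_adjoint: "gram k (\<tau> u p) [q] = gram k [p] (\<tau> (star u) q)"
    and \<tau>_mult: "gram k (\<tau> (u * v) p) [q] = gram k (concat (map (\<tau> u) (\<tau> v p))) [q]"
    and \<tau>_one: "gram k (\<tau> 1 p) [q] = k p q"
    and \<tau>_add: "gram k (\<tau> (u + v) p) [q] = gram k (\<tau> u p) [q] + gram k (\<tau> v p) [q]"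
    and \<tau>_scale: "gram k (\<tau> (c *\<^sub>C u) p) [q] = c * gram k (\<tau> u p) [q]"
begin

abbreviation ext :: "'a \<Rightarrow> 'z list \<Rightarrow> 'z list" where "ext u d \<equiv> concat (map (\<tau> u) d)"

lemma ext_adjoint: "gram k (ext u d) e = gram k d (ext (star u) e)"
  by (rule gram_adjoint) (rule \<tau>_adjoint)

lemma ext_mult: "gram k (ext (u * v) d) e = gram k (ext u (ext v d)) e"
  using gram_concat_map_cong[of k "\<tau> (u * v)" "\<lambda>p. concat (map (\<tau> u) (\<tau> v p))" d e]
  by (simp add: \<tau>_mult concat_map_concat_map)

lemma ext_one: "gram k (ext 1 d) e = gram k d e"
  using gram_concat_map_cong[of k "\<tau> 1" "\<lambda>p. [p]" d e] by (simp add: \<tau>_one gram_def[of k "[_]"])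

lemma ext_add: "gram k (ext (u + v) d) e = gram k (ext u d) e + gram k (ext v d) e"
proof -
  have "gram k (ext (u + v) d) e = gram k (concat (map (\<lambda>p. \<tau> u p @ \<tau> v p) d)) e"
    by (rule gram_concat_map_cong) (simp add: \<tau>_add)
  then show ?thesis by (simp add: gram_concat_map_left sum_list_addf)
qed

lemma ext_scale: "gram k (ext (c *\<^sub>C u) d) e = c * gram k (ext u d) e"
proof -
  have "gram k (ext (c *\<^sub>C u) d) e = gram k (concat (map (\<lambda>p. map (sc c) (\<tau> u p)) d)) e"
    by (rule gram_concat_map_cong) (simp add: \<tau>_scale)
  then show ?thesis by (simp add: gram_concat_map_left sum_list_const_mult)
qed

text \<open>Applied to d, the decomposition of 1 writes the squared seminorm of d as that of
  \<open>ext b d\<close> plus r times that of \<open>ext u d\<close>. Dropping the first term leaves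
  the bound.\<close>

lemma seminorm_ext_le: "L.seminorm (ext u d) \<le> (norm u + 1) * L.seminorm d"
proof -
  have sq: "gram k (ext (star v * v) d) d = gram k (ext v d) (ext v d)" for v
    by (simp only: ext_mult ext_adjoint[of "star v"] star_star)
  define r where "r = 1 / (norm u + 1)\<^sup>2"
  obtain b where b: "1 = star b * b + complex_of_real r *\<^sub>C (star u * u)"
    using one_eq_positive_plus_scaled[of u] unfolding r_def by blast
  have "gram k d d = gram k (ext b d) (ext b d) + complex_of_real r * gram k (ext u d) (ext u d)"
    by (subst ext_one[symmetric], subst b) (simp only: ext_add ext_scale sq)
  then have "Re (gram k d d) = Re (gram k (ext b d) (ext b d)) + r * Re (gram k (ext u d) (ext u d))"
    by simp
  moreover have "0 \<le> Re (gram k (ext b d) (ext b d))" by (rule L.Re_B_self_nonneg) simp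
  ultimately have "r * (L.seminorm (ext u d))\<^sup>2 \<le> (L.seminorm d)\<^sup>2"
    by (simp add: L.seminorm_sq)
  then have "(L.seminorm (ext u d))\<^sup>2 \<le> ((norm u + 1) * L.seminorm d)\<^sup>2"
    using zero_less_power[of "norm u + 1" 2]
    by (simp add: r_def power_mult_distrib divide_le_eq mult.commute add_nonneg_pos)
  then show ?thesis
    by (rule power2_le_imp_le) simp
qed

text \<open>As lists, the difference X of the images and the image Y of the difference may be
  distinct. They have the same pairing with every list, hence the same seminorm.\<close>

lemma sdist_ext_le: "L.sdist (ext u d) (ext u e) \<le> (norm u + 1) * L.sdist d e"
proof -
  define X Y where "X = ext u d @ map (sc (- 1)) (ext u e)" and "Y = ext u (d @ map (sc (- 1)) e)"
  have XY: "gram k X f = gram k Y f" for f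
    unfolding X_def Y_def by (simp only: gram_append_left gram_map_sc_left ext_adjoint)
  have "gram k X X = cnj (gram k Y Y)"
    using XY[of X] XY[of Y] L.B_hermitian[of Y X] by simp
  then have "L.seminorm X = L.seminorm Y" by (simp add: L.seminorm_def)
  then show ?thesis
    using seminorm_ext_le[of u "d @ map (sc (- 1)) e"] by (simp add: L.sdist_def X_def Y_def)
qed

text \<open>The value at z has to be the inner product with z. Moving u to the other side replaces z
  by the finite sum \<open>\<tau> (star u) z\<close>, over which \<open>F\<close> is summed.\<close>

definition rep :: "'a \<Rightarrow> ('z \<Rightarrow> complex) \<Rightarrow> 'z \<Rightarrow> complex" where
  "rep u F z = (\<Sum>w\<leftarrow>\<tau> (star u) z. F w)"

lemma represents_rep:
  assumes "represents d F"
  shows "represents (\<lambda>n. ext u (d n)) (rep u F)"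
  unfolding represents_def
proof (intro conjI allI)
  show "L.cauchy_seq (\<lambda>n. ext u (d n))"
    using represents_cauchy[OF assms] by (rule L.cauchy_seq_lipschitz[OF _ _ sdist_ext_le]) simp
  show "(\<lambda>n. gram k (ext u (d n)) [z]) \<longlonglongrightarrow> rep u F z" for z
    using represents_tendsto_list[OF assms, of "\<tau> (star u) z"] by (simp add: ext_adjoint rep_def)
qed

lemma rep_in [simp]: "F \<in> hcarrier rk_space \<Longrightarrow> rep u F \<in> hcarrier rk_space"
  using represents_rep unfolding in_rk_space_iff by blast

lemma rep_embed: "rep u (embed d) = embed (ext u d)"
  by (rule represents_unique[OF represents_rep[OF represents_embed] represents_embed]) simp

lemma rk_inner_rep:
  assumes "F \<in> hcarrier rk_space" "G \<in> hcarrier rk_space"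
  shows "rk_inner (rep u F) G = rk_inner F (rep (star u) G)"
proof -
  obtain d e where d: "represents d F" and e: "represents e G"
    using assms by (auto simp: in_rk_space_iff)
  show ?thesis
    using represents_inner[OF represents_rep[OF d, of u] e]
      represents_inner[OF d represents_rep[OF e, of "star u"]]
    by (auto simp: ext_adjoint intro: LIMSEQ_unique)
qed

lemma seminorm_rep_le:
  assumes "F \<in> hcarrier rk_space"
  shows "R.seminorm (rep u F) \<le> (norm u + 1) * R.seminorm F"
proof -
  obtain d where d: "represents d F" using assms by (auto simp: in_rk_space_iff)
  show ?thesis
  proof (rule LIMSEQ_le)
    show "(\<lambda>n. L.seminorm (ext u (d n))) \<longlonglongrightarrow> R.seminorm (rep u F)"
      by (intro represents_norm represents_rep d)
    show "(\<lambda>n. (norm u + 1) * L.seminorm (d n)) \<longlonglongrightarrow> (norm u + 1) * R.seminorm F"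
      by (intro tendsto_mult tendsto_const represents_norm d)
  qed (auto intro: seminorm_ext_le)
qed

theorem unital_star_rep_rep: "unital_star_rep rk_space rep"
  unfolding unital_star_rep_def linear_to_B_def unital_to_B_def bounded_op_def linear_op_def hnorm_rk
proof (intro conjI allI ballI)
  fix u v c and F G :: "'z \<Rightarrow> complex"
  assume F: "F \<in> hcarrier rk_space"
  then obtain d where d: "represents d F" by (auto simp: in_rk_space_iff)
  show "rep u F \<in> hcarrier rk_space" using F by simp
  show "rep u (hadd rk_space F G) = hadd rk_space (rep u F) (rep u G)"
    by (simp add: rep_def fun_eq_iff sum_list_addf)
  show "rep u (hscale rk_space c F) = hscale rk_space c (rep u F)"
    by (simp add: rep_def fun_eq_iff sum_list_const_mult)
  show "rep (u + v) F = hadd rk_space (rep u F) (rep v F)"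
    unfolding rk_space_simps
    by (rule represents_unique[OF represents_rep[OF d]
          represents_add[OF represents_rep[OF d] represents_rep[OF d]]])
      (simp add: ext_add)
  show "rep (c *\<^sub>C u) F = hscale rk_space c (rep u F)"
    unfolding rk_space_simps
    by (rule represents_unique[OF represents_rep[OF d] represents_scale[OF represents_rep[OF d]]])
      (simp add: ext_scale)
  show "rep 1 F = F"
    by (rule represents_unique[OF represents_rep[OF d] d]) (simp add: ext_one)
  show "rep (u * v) F = rep u (rep v F)"
    by (rule represents_unique[OF represents_rep[OF d] represents_rep[OF represents_rep[OF d]]])
      (simp add: ext_mult)
  show "rep (star u) F = adj_op rk_space rk_space (rep u) F"
    by (rule hilbert_space.adj_op_eqI[OF hilbert_space_rk, symmetric]) (simp_all add: F rk_inner_rep)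
qed (use seminorm_rep_le in blast)

end

text \<open>The sequences representing two vectors do not depend on x. A coefficient is therefore a
  pointwise limit of a sequence of finite sums of coefficients between generators.\<close>

lemma measurable_family_rep:
  fixes \<tau> :: "'x \<Rightarrow> 'a :: unital_cstar_algebra \<Rightarrow> 'z \<Rightarrow> 'z list"
  assumes rep: "\<And>x. kernel_rep k sc (\<tau> x)"
    and meas: "\<And>u p q. (\<lambda>x. gram k (\<tau> x u p) [q]) \<in> borel_measurable (completion M)"
  shows "measurable_family M (kernel.rk_space k sc) (\<lambda>x. kernel_rep.rep (\<tau> x))"
proof -
  interpret kernel k sc using rep unfolding kernel_rep_def by blast
  show ?thesis
    unfolding measurable_family_def
  proof (intro allI ballI)
    fix u F G assume "F \<in> hcarrier rk_space" "G \<in> hcarrier rk_space"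
    then obtain d e where d: "represents d F" and e: "represents e G"
      by (auto simp: in_rk_space_iff)
    have m: "(\<lambda>x. gram k (concat (map (\<tau> x u) d)) e) \<in> borel_measurable (completion M)" for d e
    proof -
      have "(\<lambda>x. \<Sum>q\<leftarrow>e. gram k (\<tau> x u p) [q]) \<in> borel_measurable (completion M)" for p
        by (induction e) (auto intro!: borel_measurable_add meas)
      then have "(\<lambda>x. gram k (\<tau> x u p) e) \<in> borel_measurable (completion M)" for p
        by (subst gram_conv_right)
      then show ?thesis
        by (induction d) (auto intro!: borel_measurable_add)
    qed
    show "(\<lambda>x. hinner rk_space (kernel_rep.rep (\<tau> x) u F) G) \<in> borel_measurable (completion M)"
    proof (rule borel_measurable_LIMSEQ_metric)
      show "(\<lambda>x. gram k (concat (map (\<tau> x u) (d n))) (e n)) \<in> borel_measurable (completion M)" for n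
        by (rule m)
      show "(\<lambda>n. gram k (concat (map (\<tau> x u) (d n))) (e n))
          \<longlonglongrightarrow> hinner rk_space (kernel_rep.rep (\<tau> x) u F) G" for x
        using represents_inner[OF kernel_rep.represents_rep[OF rep d] e] by simp
    qed
  qed
qed

section \<open>The dilation space of a family of completely positive maps\<close>

lemma gram_cong:
  assumes "\<And>p q. \<lbrakk>p \<in> set d; q \<in> set e\<rbrakk> \<Longrightarrow> k p q = k' p q"
  shows "gram k d e = gram k' d e"
  unfolding gram_def using assms by (intro arg_cong[of _ _ sum_list] map_cong) auto

lemma gram_eq_0:
  assumes "\<And>p q. \<lbrakk>p \<in> set d; q \<in> set e\<rbrakk> \<Longrightarrow> k p q = 0"
  shows "gram k d e = 0"
proof -
  have "gram k d e = gram (\<lambda>p q. 0) d e" by (rule gram_cong) (rule assms)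
  then show ?thesis by (simp add: gram_def)
qed

lemma gram_map: "gram k (map g d) (map g e) = gram (\<lambda>p q. k (g p) (g q)) d e"
  by (simp add: gram_def o_def)

lemma gram_partition_left:
  "gram k d e = gram k (filter P d) e + gram k (filter (\<lambda>p. \<not> P p) d) e"
  by (induction d) (simp_all add: gram_Cons_left)

lemma gram_partition_right:
  "gram k d e = gram k d (filter P e) + gram k d (filter (\<lambda>p. \<not> P p) e)"
  by (induction e) (simp_all add: gram_Cons_right)

text \<open>The entries in the block of the first one are split off; the cross terms vanish and the
  rest is a shorter list.\<close>

lemma gram_nonneg_if_block_diagonal:
  assumes "\<And>p q. key p \<noteq> key q \<Longrightarrow> k p q = 0"
    and "\<And>d b. (\<And>p. p \<in> set d \<Longrightarrow> key p = b) \<Longrightarrow> gram k d d \<in> \<real>\<^sub>\<ge>\<^sub>0"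
  shows "gram k d d \<in> \<real>\<^sub>\<ge>\<^sub>0"
proof (induction "length d" arbitrary: d rule: less_induct)
  case less
  show ?case
  proof (cases d)
    case (Cons p d')
    let ?in = "filter (\<lambda>q. key q = key p) d" and ?out = "filter (\<lambda>q. key q \<noteq> key p) d"
    have "gram k d d = gram k ?in d + gram k ?out d" by (rule gram_partition_left)
    also have "gram k ?in d = gram k ?in ?in + gram k ?in ?out" by (rule gram_partition_right)
    also have "gram k ?out d = gram k ?out ?in + gram k ?out ?out" by (rule gram_partition_right)
    also have "gram k ?in ?out = 0"
      using assms(1) by (intro gram_eq_0) auto
    also have "gram k ?out ?in = 0"
      using assms(1) by (intro gram_eq_0) auto
    finally have "gram k d d = gram k ?in ?in + gram k ?out ?out" by simp
    moreover have "gram k ?in ?in \<in> \<real>\<^sub>\<ge>\<^sub>0" by (rule assms(2)[of _ "key p"]) auto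
    moreover have "gram k ?out ?out \<in> \<real>\<^sub>\<ge>\<^sub>0"
      using Cons by (intro less) (simp add: le_imp_less_Suc)
    ultimately show ?thesis by simp
  qed simp
qed

text \<open>The maps enter through the coefficients \<open>ip (f x u \<xi>) \<eta>\<close>, without
  carrier conditions. The last law is positivity of the Stinespring form, where
  \<open>(u, \<xi>)\<close> stands for u \<otimes> \<xi>.\<close>

locale cp_family =
  fixes ip :: "'h \<Rightarrow> 'h \<Rightarrow> complex" and s :: "complex \<Rightarrow> 'h \<Rightarrow> 'h"
    and f :: "'x \<Rightarrow> 'a :: unital_cstar_algebra \<Rightarrow> 'h \<Rightarrow> 'h"
  assumes ip_s_left [simp]: "ip (s c \<xi>) \<eta> = c * ip \<xi> \<eta>"
    and ip_hermitian: "ip \<xi> \<eta> = cnj (ip \<eta> \<xi>)"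
    and f_add: "ip (f x (u + v) \<xi>) \<eta> = ip (f x u \<xi>) \<eta> + ip (f x v \<xi>) \<eta>"
    and f_scale: "ip (f x (c *\<^sub>C u) \<xi>) \<eta> = c * ip (f x u \<xi>) \<eta>"
    and f_one [simp]: "ip (f x 1 \<xi>) \<eta> = ip \<xi> \<eta>"
    and f_s [simp]: "ip (f x u (s c \<xi>)) \<eta> = c * ip (f x u \<xi>) \<eta>"
    and gram_f_nonneg: "gram (\<lambda>(u, \<xi>) (v, \<eta>). ip (f x (star v * u) \<xi>) \<eta>) l l \<in> \<real>\<^sub>\<ge>\<^sub>0"
begin

lemma ip_s_right [simp]: "ip \<xi> (s c \<eta>) = cnj c * ip \<xi> \<eta>"
  using ip_hermitian[of \<xi> "s c \<eta>"] ip_hermitian[of \<xi> \<eta>] by simp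

text \<open>This is Hermitian symmetry of the Stinespring form at \<open>(1, \<xi>)\<close> and
  \<open>(u, \<eta>)\<close>.\<close>

lemma f_adjoint [simp]: "ip (f x (star u) \<xi>) \<eta> = ip \<xi> (f x u \<eta>)"
proof -
  interpret kernel "\<lambda>(u, \<xi>) (v, \<eta>). ip (f x (star v * u) \<xi>) \<eta>" "\<lambda>c (u, \<xi>). (u, s c \<xi>)"
    by unfold_locales (auto simp: gram_f_nonneg)
  show ?thesis
    using L.B_hermitian[of "[(1, \<xi>)]" "[(u, \<eta>)]"] ip_hermitian[of \<xi> "f x u \<eta>"]
    by (simp add: gram_def)
qed

text \<open>For \<open>n > 0\<close> the generator \<open>(x, u, \<xi>, n)\<close> stands for the vector \<open>u \<otimes> \<xi>\<close> in the \<open>n\<close>-th copy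
  of the Stinespring space of \<open>f x\<close>, while \<open>(x, u, \<xi>, 0)\<close> stands for the vector \<open>\<xi>\<close> of the given
  space, whatever \<open>x\<close> and \<open>u\<close> are.\<close>

fun kern :: "'x \<times> 'a \<times> 'h \<times> nat \<Rightarrow> 'x \<times> 'a \<times> 'h \<times> nat \<Rightarrow> complex" where
  "kern (x, u, \<xi>, n) (y, v, \<eta>, m) =
     (if n \<noteq> m then 0 else if n = 0 then ip \<xi> \<eta>
      else if x = y then ip (f x (star v * u) \<xi>) \<eta> else 0)"

fun sc :: "complex \<Rightarrow> 'x \<times> 'a \<times> 'h \<times> nat \<Rightarrow> 'x \<times> 'a \<times> 'h \<times> nat" where
  "sc c (x, u, \<xi>, n) = (x, u, s c \<xi>, n)"

lemma gram_kern_nonneg: "gram kern d d \<in> \<real>\<^sub>\<ge>\<^sub>0"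
proof (rule gram_nonneg_if_block_diagonal)
  \<comment> \<open>The given space at level 0 is one block; above it each copy of each Stinespring
    space is a block.\<close>
  let ?key = "\<lambda>(x, u, \<xi>, n). if n = 0 then None else Some (x, n)"
  show "kern p q = 0" if "?key p \<noteq> ?key q" for p q
    using that by (cases p; cases q) (auto split: if_splits)
  fix d :: "('x \<times> 'a \<times> 'h \<times> nat) list" and b
  assume b: "\<And>p. p \<in> set d \<Longrightarrow> ?key p = b"
  show "gram kern d d \<in> \<real>\<^sub>\<ge>\<^sub>0"
  proof (cases b)
    case None
    \<comment> \<open>As the maps are unital, the Stinespring form of each of them restricts to
      \<open>ip\<close> on the vectors \<open>(1, \<xi>)\<close>; the index \<open>undefined\<close>
      is one choice.\<close>
    have "gram kern d d
        = gram (\<lambda>(u, \<xi>) (v, \<eta>). ip (f undefined (star v * u) \<xi>) \<eta>)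
            (map (\<lambda>(x, u, \<xi>, n). (1, \<xi>)) d) (map (\<lambda>(x, u, \<xi>, n). (1, \<xi>)) d)"
      unfolding gram_map
    proof (rule gram_cong)
      fix p q assume "p \<in> set d" "q \<in> set d"
      then have "?key p = None" "?key q = None" using b None by auto
      then show "kern p q = (case case p of (x, u, \<xi>, n) \<Rightarrow> (1, \<xi>) of (u, \<xi>) \<Rightarrow> \<lambda>(v, \<eta>).
          ip (f undefined (star v * u) \<xi>) \<eta>) (case q of (x, u, \<xi>, n) \<Rightarrow> (1, \<xi>))"
        by (cases p; cases q) (auto split: if_splits)
    qed
    then show ?thesis by (simp only: gram_f_nonneg)
  next
    case (Some xn)
    obtain x n where "xn = (x, n)" by (cases xn)
    have "gram kern d d
        = gram (\<lambda>(u, \<xi>) (v, \<eta>). ip (f x (star v * u) \<xi>) \<eta>)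
            (map (\<lambda>(x, u, \<xi>, n). (u, \<xi>)) d) (map (\<lambda>(x, u, \<xi>, n). (u, \<xi>)) d)"
      unfolding gram_map
    proof (rule gram_cong)
      fix p q assume "p \<in> set d" "q \<in> set d"
      then have "?key p = Some (x, n)" "?key q = Some (x, n)" using b Some \<open>xn = (x, n)\<close> by auto
      then show "kern p q = (case case p of (x, u, \<xi>, n) \<Rightarrow> (u, \<xi>) of (u, \<xi>) \<Rightarrow> \<lambda>(v, \<eta>).
          ip (f x (star v * u) \<xi>) \<eta>) (case q of (x, u, \<xi>, n) \<Rightarrow> (u, \<xi>))"
        by (cases p; cases q) (auto split: if_splits)
    qed
    then show ?thesis by (simp only: gram_f_nonneg)
  qed
qed

sublocale kernel kern sc
proof
  show "kern (sc c p) q = c * kern p q" "kern p (sc c q) = cnj c * kern p q" for c p q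
    by (cases p; cases q; simp)+
qed (rule gram_kern_nonneg)

text \<open>\<open>swap x\<close> is the unitary from the given space plus all copies with \<open>n > 0\<close> onto the copies
  with \<open>n > 0\<close>: in the copies of the Stinespring space of \<open>f x\<close> it moves the component in the
  given space one copy up and fixes the component orthogonal to it.\<close>

fun swap :: "'x \<Rightarrow> 'x \<times> 'a \<times> 'h \<times> nat \<Rightarrow> ('x \<times> 'a \<times> 'h \<times> nat) list" where
  "swap x (y, v, \<xi>, n) =
     (if n = 0 then [(x, 1, \<xi>, 1)]
      else if y = x then [(x, v, \<xi>, n), (x, 1, s (- 1) (f x v \<xi>), n), (x, 1, f x v \<xi>, Suc n)]
      else [(y, v, \<xi>, n)])"

text \<open>The adjoint of \<open>swap x\<close>. It kills level 0, which is orthogonal to the range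
  of \<open>swap x\<close>. In the copies for x, the projection 1 \<otimes> f x v \<xi> of v
  \<otimes> \<xi> to the given space moves one copy down and reaches level 0 from level 1.\<close>

fun unswap :: "'x \<Rightarrow> 'x \<times> 'a \<times> 'h \<times> nat \<Rightarrow> ('x \<times> 'a \<times> 'h \<times> nat) list" where
  "unswap x (y, v, \<xi>, n) =
     (if n = 0 then []
      else if y = x then [(x, v, \<xi>, n), (x, 1, s (- 1) (f x v \<xi>), n), (x, 1, f x v \<xi>, n - 1)]
      else [(y, v, \<xi>, n)])"

text \<open>The Stinespring representations on all copies at once, extended by zero to level 0,
  which is orthogonal to the range of \<open>swap x\<close>.\<close>

fun lmult :: "'a \<Rightarrow> 'x \<times> 'a \<times> 'h \<times> nat \<Rightarrow> ('x \<times> 'a \<times> 'h \<times> nat) list" where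
  "lmult u (y, v, \<xi>, n) = (if n = 0 then [] else [(y, u * v, \<xi>, n)])"

abbreviation lift :: "('b \<Rightarrow> 'c list) \<Rightarrow> 'b list \<Rightarrow> 'c list" where
  "lift T d \<equiv> concat (map T d)"

text \<open>Conjugation by the unitary \<open>swap x\<close> transports the left multiplication from
  the levels above 0 to the whole space.\<close>

definition dil :: "'x \<Rightarrow> 'a \<Rightarrow> 'x \<times> 'a \<times> 'h \<times> nat \<Rightarrow> ('x \<times> 'a \<times> 'h \<times> nat) list" where
  "dil x u p = lift (unswap x) (lift (lmult u) (swap x p))"

section \<open>The laws of the dilated representation\<close>

lemma swap_adjoint: "gram kern (swap x p) [q] = gram kern [p] (unswap x q)"
  by (cases p; cases q) (auto simp: gram_def)

lemma unswap_adjoint: "gram kern (unswap x p) [q] = gram kern [p] (swap x q)"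
  using swap_adjoint[of x q p] L.B_hermitian[of "unswap x p" "[q]"] L.B_hermitian[of "[p]" "swap x q"]
  by simp

lemma lmult_adjoint: "gram kern (lmult u p) [q] = gram kern [p] (lmult (star u) q)"
  by (cases p; cases q) (auto simp: gram_def star_mult star_star mult.assoc)

lemma unswap_swap: "gram kern (lift (unswap x) (swap x p)) [q] = kern p q"
  by (cases p; cases q) (auto simp: gram_def)

text \<open>\<open>swap x\<close> after \<open>unswap x\<close> is the projection onto the levels
  above 0, which contain the image of \<open>lmult u\<close>.\<close>

lemma swap_unswap_lmult:
  "gram kern (lift (swap x) (lift (unswap x) (lmult u p))) [q] = gram kern (lmult u p) [q]"
  by (cases p; cases q) (auto simp: gram_def)

lemma lmult_mult: "lift (lmult (u * v)) d = lift (lmult u) (lift (lmult v) d)"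
proof (induction d)
  case (Cons p d)
  then show ?case by (cases p) (simp add: mult.assoc)
qed simp

lemma lmult_one_swap: "lift (lmult 1) (swap x p) = swap x p"
  by (cases p) simp

lemma lmult_add: "gram kern (lmult (u + v) p) [q] = gram kern (lmult u p @ lmult v p) [q]"
  by (cases p; cases q) (simp add: gram_def distrib_left distrib_right f_add)

lemma lmult_scale: "gram kern (lmult (c *\<^sub>C u) p) [q] = gram kern (map (sc c) (lmult u p)) [q]"
  by (cases p; cases q) (simp add: gram_def mult_scaleC_left mult_scaleC_right f_scale)

lemma gram_dil: "gram kern (dil x u p) e = gram kern (lift (lmult u) (swap x p)) (lift (swap x) e)"
  unfolding dil_def by (rule gram_adjoint) (rule unswap_adjoint)

lemma lift_dil: "lift (dil x u) d = lift (unswap x) (lift (lmult u) (lift (swap x) d))"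
  unfolding dil_def concat_map_concat_map ..

lemma kernel_rep_dil: "kernel_rep kern sc (dil x)"
proof
  fix u v c p q
  note adj = gram_adjoint[of kern, OF lmult_adjoint] gram_adjoint[of kern, OF swap_adjoint]
    gram_adjoint[of kern, OF unswap_adjoint]
  show "gram kern (dil x u p) [q] = gram kern [p] (dil x (star u) q)"
    using adj(2)[of x "[p]" "lift (lmult (star u)) (swap x q)"]
    by (simp add: gram_dil adj(1)) (simp add: dil_def)
  have "gram kern (lift (dil x u) (dil x v p)) [q] =
      gram kern (lift (swap x) (lift (unswap x) (lift (lmult v) (swap x p))))
        (lift (lmult (star u)) (swap x q))"
    unfolding lift_dil by (simp add: adj(1,3)) (simp add: dil_def)
  \<comment> \<open>The projection between the two multiplications is the identity on the image of
    \<open>lmult v\<close>.\<close>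
  also have "\<dots> = gram kern (lift (lmult v) (swap x p)) (lift (lmult (star u)) (swap x q))"
    unfolding concat_map_concat_map[symmetric]
    by (rule gram_concat_map_cong) (rule swap_unswap_lmult[unfolded concat_map_concat_map[symmetric]])
  also have "\<dots> = gram kern (dil x (u * v) p) [q]"
    by (simp add: gram_dil lmult_mult adj(1))
  finally show "gram kern (dil x (u * v) p) [q] = gram kern (lift (dil x u) (dil x v p)) [q]" ..
  show "gram kern (dil x 1 p) [q] = kern p q"
    unfolding dil_def lmult_one_swap by (rule unswap_swap)
  show "gram kern (dil x (u + v) p) [q] = gram kern (dil x u p) [q] + gram kern (dil x v p) [q]"
    unfolding gram_dil gram_concat_map_cong[of kern, OF lmult_add]
    by (simp add: gram_concat_map_left sum_list_addf)
  show "gram kern (dil x (c *\<^sub>C u) p) [q] = c * gram kern (dil x u p) [q]"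
    unfolding gram_dil gram_concat_map_cong[of kern, OF lmult_scale]
    by (simp add: gram_concat_map_left sum_list_const_mult)
qed

text \<open>The vector \<xi> is lifted to 1 \<otimes> \<xi> at level 1 and multiplied to u \<otimes>
  \<xi>, whose component f x u \<xi> in the given space comes down to level 0. The rest is
  orthogonal to level 0. This is the dilation identity.\<close>

lemma gram_dil_level_0:
  "gram kern [(y, v, \<eta>, 0)] (dil x u (z, w, \<xi>, 0)) = ip \<eta> (f x u \<xi>)"
  by (simp add: dil_def gram_def)

text \<open>The coefficient agrees with a measurable function off two points.\<close>

lemma measurable_gram_dil:
  assumes meas: "\<And>u \<xi> \<eta>. (\<lambda>x. ip (f x u \<xi>) \<eta>) \<in> borel_measurable M"
    and space: "space M = UNIV" and singletons: "\<And>x. {x} \<in> sets M"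
  shows "(\<lambda>x. gram kern (dil x u p) [q]) \<in> borel_measurable M"
proof -
  obtain y v \<xi> n z w \<eta> m where [simp]: "p = (y, v, \<xi>, n)" "q = (z, w, \<eta>, m)"
    by (cases p; cases q) auto
  \<comment> \<open>Off the base points, a generator above level 0 is fixed by \<open>swap x\<close>
    and \<open>unswap x\<close>, which leaves a constant. A generator of level 0 yields terms at
    level 0 and over x, so q sees them at level 0 only.\<close>
  let ?g = "\<lambda>x. if n = 0 then if m = 0 then ip (f x u \<xi>) \<eta> else 0 else kern (y, u * v, \<xi>, n) q"
  have "?g \<in> borel_measurable M"
    by (cases "n = 0"; cases "m = 0") (simp_all add: meas)
  then show ?thesis
  proof (rule measurable_discrete_difference[where X = "{y, z}"])
    fix x assume "x \<notin> {y, z}"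
    then have "y \<noteq> x" "x \<noteq> z" by auto
    then show "?g x = gram kern (dil x u p) [q]"
      by (cases "n = 0"; cases "m = 0"; simp add: dil_def gram_def)
  qed (use space singletons in simp_all)
qed

end

section \<open>Completely positive maps and the dilation theorem\<close>

lemma completely_positive_gram_nonneg:
  assumes cp: "completely_positive H \<phi>" and l: "\<And>u \<xi>. (u, \<xi>) \<in> set l \<Longrightarrow> \<xi> \<in> hcarrier H"
  shows "gram (\<lambda>(u, \<xi>) (v, \<eta>). hinner H (\<phi> (star v * u) \<xi>) \<eta>) l l \<in> \<real>\<^sub>\<ge>\<^sub>0"
proof -
  let ?n = "length l" and ?u = "\<lambda>i. fst (l ! i)" and ?\<xi> = "\<lambda>i. snd (l ! i)"
  have "positive_matrix ?n (\<lambda>i j. star (?u i) * ?u j)"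
    unfolding positive_matrix_def
  \<comment> \<open>Row 0 of the factor b holds the algebra elements and its other rows vanish; row
    0 exists because \<open>i < ?n\<close>.\<close>
  proof (intro exI[of _ "\<lambda>k i. if k = 0 then ?u i else 0"] allI impI)
    fix i j assume "i < ?n"
    have "star (if k = 0 then ?u i else 0) * (if k = 0 then ?u j else 0)
        = (if k = 0 then star (?u i) * ?u j else 0)" for k :: nat
      by simp
    then show "star (?u i) * ?u j
        = (\<Sum>k<?n. star (if k = 0 then ?u i else 0) * (if k = 0 then ?u j else 0))"
      using \<open>i < ?n\<close> by auto
  qed
  then have "positive_op_matrix H ?n (\<lambda>i j. \<phi> (star (?u i) * ?u j))"
    using cp by (auto simp: completely_positive_def)
  moreover have "\<forall>i<?n. ?\<xi> i \<in> hcarrier H"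
    using l by (metis nth_mem prod.collapse)
  ultimately have "(\<Sum>i<?n. \<Sum>j<?n. hinner H (\<phi> (star (?u i) * ?u j) (?\<xi> j)) (?\<xi> i)) \<in> \<real>\<^sub>\<ge>\<^sub>0"
    by (simp add: positive_op_matrix_def)
  also have "(\<Sum>i<?n. \<Sum>j<?n. hinner H (\<phi> (star (?u i) * ?u j) (?\<xi> j)) (?\<xi> i))
      = gram (\<lambda>(u, \<xi>) (v, \<eta>). hinner H (\<phi> (star v * u) \<xi>) \<eta>) l l"
    \<comment> \<open>The outer sum of \<open>gram\<close> runs over the vectors that are acted on,
      here indexed by j.\<close>
    by (subst sum.swap) (simp add: gram_def sum_list_sum_nth case_prod_unfold atLeast0LessThan)
  finally show ?thesis .
qed

theorem theorem4p1:
  fixes \<mu> :: "'x :: {second_countable_topology, t2_space} measure"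
    and H :: "'h hilbert"
    and \<phi> :: "'x \<Rightarrow> 'a :: unital_cstar_algebra \<Rightarrow> 'h \<Rightarrow> 'h"
  assumes "compact (UNIV :: 'x set)"
    and "separable_space (euclidean :: 'a topology)"
    and "hilbert_space H"
    and "sets \<mu> = sets borel" and "prob_space \<mu>" and "nonatomic \<mu>"
    and "\<And>x. completely_positive H (\<phi> x)" and "\<And>x. unital_to_B H (\<phi> x)"
    and "measurable_family \<mu> H \<phi>"
  shows "\<exists>(K :: ('x, 'a, 'h) dilation_vec hilbert) V \<pi>.
           hilbert_space K \<and> isometry_op H K V \<and>
           (\<forall>x. unital_star_rep K (\<pi> x)) \<and> measurable_family \<mu> K \<pi> \<and>
           (\<forall>x u. \<forall>\<xi>\<in>hcarrier H. \<phi> x u \<xi> = adj_op H K V (\<pi> x u (V \<xi>)))"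
proof -
  interpret H: hilbert_space H by fact
  interpret HS: semi_inner "hcarrier H" "hadd H" "hscale H" "hinner H"
    by (rule hilbert_space_semi_inner) fact
  text \<open>Vectors off the carrier are read as the zero vector, so that no carrier conditions are
    needed for the generators of the dilation space.\<close>
  define cl where "cl \<xi> = (if \<xi> \<in> hcarrier H then \<xi> else hzero H)" for \<xi>
  have cl_in [simp]: "cl \<xi> \<in> hcarrier H" for \<xi> by (simp add: cl_def H.zero_closed)
  have cl_id [simp]: "cl \<xi> = \<xi>" if "\<xi> \<in> hcarrier H" for \<xi> using that by (simp add: cl_def)
  define ip where "ip \<xi> \<eta> = hinner H (cl \<xi>) (cl \<eta>)" for \<xi> \<eta>
  define s where "s c \<xi> = hscale H c (cl \<xi>)" for c \<xi>
  define f where "f x u \<xi> = \<phi> x u (cl \<xi>)" for x u \<xi>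
  have lin: "linear_to_B H (\<phi> x)" for x
    using assms(7)[of x] by (simp add: completely_positive_def)
  have \<phi>_in [simp]: "\<phi> x u \<xi> \<in> hcarrier H" if "\<xi> \<in> hcarrier H" for x u \<xi>
    using lin[of x] that by (simp add: linear_to_B_def bounded_op_def linear_op_def)
  interpret cp_family ip s f
  proof
    fix x u v c \<xi> \<eta> l
    show "ip (s c \<xi>) \<eta> = c * ip \<xi> \<eta>" by (simp add: ip_def s_def)
    show "ip \<xi> \<eta> = cnj (ip \<eta> \<xi>)" unfolding ip_def by (rule HS.B_hermitian) simp_all
    show "ip (f x (u + v) \<xi>) \<eta> = ip (f x u \<xi>) \<eta> + ip (f x v \<xi>) \<eta>"
      using lin[of x] by (simp add: ip_def f_def linear_to_B_def)
    show "ip (f x (c *\<^sub>C u) \<xi>) \<eta> = c * ip (f x u \<xi>) \<eta>"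
      using lin[of x] by (simp add: ip_def f_def linear_to_B_def)
    show "ip (f x 1 \<xi>) \<eta> = ip \<xi> \<eta>"
      using assms(8)[of x] by (simp add: ip_def f_def unital_to_B_def)
    show "ip (f x u (s c \<xi>)) \<eta> = c * ip (f x u \<xi>) \<eta>"
      using lin[of x] by (simp add: ip_def f_def s_def linear_to_B_def bounded_op_def linear_op_def)
    show "gram (\<lambda>(u, \<xi>) (v, \<eta>). ip (f x (star v * u) \<xi>) \<eta>) l l \<in> \<real>\<^sub>\<ge>\<^sub>0"
    proof -
      have "gram (\<lambda>(u, \<xi>) (v, \<eta>). ip (f x (star v * u) \<xi>) \<eta>) l l
          = gram (\<lambda>(u, \<xi>) (v, \<eta>). hinner H (\<phi> x (star v * u) \<xi>) \<eta>)
              (map (apsnd cl) l) (map (apsnd cl) l)"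
        unfolding gram_map by (rule gram_cong) (auto simp: ip_def f_def)
      also have "\<dots> \<in> \<real>\<^sub>\<ge>\<^sub>0"
        by (intro completely_positive_gram_nonneg assms(7)) auto
      finally show ?thesis .
    qed
  qed
  interpret rep: kernel_rep kern sc "dil x" for x by (rule kernel_rep_dil)
  \<comment> \<open>A generator of level 0 stands for its third component; \<open>undefined\<close>
    and 1 are fillers.\<close>
  define V where "V \<xi> = embed [(undefined, 1, \<xi>, 0)]" for \<xi>
  \<comment> \<open>The dilation identity in weak form, as \<open>adj_op_eqI\<close> takes
    it.\<close>
  have rk_inner_V: "rk_inner (V \<eta>) (rep.rep x u (V \<xi>)) = hinner H \<eta> (\<phi> x u \<xi>)"
    if "\<xi> \<in> hcarrier H" "\<eta> \<in> hcarrier H" for x u \<xi> \<eta>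
    using that by (simp add: V_def rep.rep_embed gram_dil_level_0) (simp add: ip_def f_def)
  have V: "isometry_op H rk_space V"
    unfolding isometry_op_def linear_op_def
  proof (intro conjI allI ballI)
    fix c \<xi> assume \<xi>: "\<xi> \<in> hcarrier H"
    show "V \<xi> \<in> hcarrier rk_space" by (simp add: V_def)
    show "V (hscale H c \<xi>) = hscale rk_space c (V \<xi>)"
      using \<xi> by (auto simp: V_def embed_def gram_def fun_eq_iff ip_def)
    show "hnorm rk_space (V \<xi>) = hnorm H \<xi>"
      using \<xi> by (simp add: V_def hnorm_def) (simp add: gram_def ip_def)
    fix \<eta> assume "\<eta> \<in> hcarrier H"
    then show "V (hadd H \<xi> \<eta>) = hadd rk_space (V \<xi>) (V \<eta>)"
      using \<xi> by (auto simp: V_def embed_def gram_def fun_eq_iff ip_def)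
  qed
  have "(\<lambda>x. gram kern (dil x u p) [q]) \<in> borel_measurable (completion \<mu>)" for u p q
  proof (rule measurable_gram_dil)
    show "(\<lambda>x. ip (f x u \<xi>) \<eta>) \<in> borel_measurable (completion \<mu>)" for u \<xi> \<eta>
      using assms(9) by (simp add: measurable_family_def ip_def f_def)
    show "space (completion \<mu>) = UNIV"
      using sets_eq_imp_space_eq[OF assms(4)] by simp
    \<comment> \<open>Points of a Hausdorff space are closed, hence Borel.\<close>
    show "{x} \<in> sets (completion \<mu>)" for x
      using assms(4) by (intro sets_completionI_sets) simp
  qed
  then have "measurable_family \<mu> rk_space rep.rep"
    by (intro measurable_family_rep kernel_rep_dil)
  moreover have "\<phi> x u \<xi> = adj_op H rk_space V (rep.rep x u (V \<xi>))" if "\<xi> \<in> hcarrier H" for x u \<xi>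
    using that by (intro H.adj_op_eqI[symmetric]) (simp_all add: rk_inner_V)
  ultimately show ?thesis
    using hilbert_space_rk V rep.unital_star_rep_rep
    by (intro exI[of _ rk_space] exI[of _ V] exI[of _ rep.rep]) simp
qed

end
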